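(* Let $\mathscr{S}=(\mathscr{S}(t))_{t\ge 0}$ be the semigroup envelope of the family $(S_\lambda)_{\lambda\in\Lambda}$. Then $\mathscr{S}$ is a Feller semigroup of sublinear operators on $\mathrm{UC}_\kappa$, and $\mathscr{S}$ is the least upper bound of the family $(S_\lambda)_{\lambda\in\Lambda}$.
   Context: Setting: $\Lambda$ is a nonempty set, $(M,d)$ is a separable metric space, and $\kappa\colon M\to(0,\infty)$ is continuous and bounded. $\|u\|_\infty=\sup_{x\in M}|u(x)|$; $\|u\|_\kappa=\|\kappa u\|_\infty$; $\|u\|_{\mathrm{Lip}}=\inf\{L\ge 0: |u(x)-u(y)|\le L d(x,y)\ \forall x,y\in M\}$. $\mathrm{C}_\kappa$ is the space of continuous $u\colon M\to\mathbb{R}$ with $\|u\|_\kappa<\infty$; $\mathrm{Lip}_{\rm b}$ is the space of bounded Lipschitz functions $M\to\mathbb{R}$; $\mathrm{UC}_\kappa$ is the closure of $\mathrm{Lip}_{\rm b}$ in $(\mathrm{C}_\kappa,\|\cdot\|_\kappa)$. Order and inequalities between functions are pointwise. For $u_n,u\in\mathrm{UC}_\kappa$, $u_n\nearrow u$ means $u_n\le u_{n+1}$ for all $n$ and $u_n(x)\to u(x)$ for all $x\in M$. A Feller semigroup is a family $T=(T(t))_{t\ge0}$ of possibly nonlinear operators such that (i) $T(t)\colon\mathrm{UC}_\kappa\to\mathrm{UC}_\kappa$ is ($\|\cdot\|_\kappa$-)continuous for all $t\ge 0$; (ii) $T(0)u=u$ and $T(s+t)u=T(s)T(t)u$ for all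 $s,t\ge0$, $u\in\mathrm{UC}_\kappa$; (iii) each $T(t)$ is monotone and continuous from below, i.e. $u_n\nearrow u$ in $\mathrm{UC}_\kappa$ implies $T(t)u_n\nearrow T(t)u$. No strong continuity is assumed. Standing assumptions: (A1) for every $\lambda\in\Lambda$, $S_\lambda=(S_\lambda(t))_{t\ge0}$ is a Feller semigroup of linear operators with $S_\lambda(t)1=1$ for all $t\geq 0$; (A2) there are $\alpha,\beta\in\mathbb{R}$ with $\|S_\lambda(t)u\|_\kappa\le e^{\alpha t}\|u\|_\kappa$ and $\|S_\lambda(t)u\|_{\mathrm{Lip}}\le e^{\beta t}\|u\|_{\mathrm{Lip}}$ for all $u\in\mathrm{Lip}_{\rm b}$, $\lambda\in\Lambda$, $t\ge0$. For $h\ge0$, $u\in\mathrm{UC}_\kappa$: $(\mathcal{E}_hu)(x)=\sup_{\lambda\in\Lambda}(S_\lambda(h)u)(x)$; $\mathcal{E}_h$ maps $\mathrm{UC}_\kappa$ to itself. $P$ is the set of finite subsets $\pi\subset[0,\infty)$ with $0\in\pi$, and $P_t=\{\pi\in P:\max\pi=t\}$. For $\pi=\{t_0,\dots,t_m\}$ with $0=t_0<t_1<\dots<t_m$, $m\ge 1$, $\mathcal{E}_\pi u=\mathcal{E}_{t_1-t_0}\cdots\mathcal{E}_{t_m-t_{m-1}}u$ (composition), and $\mathcal{E}_{\{0\}}u=u$. The semigroup envelope is defined by $(\mathscr{S}(t)u)(x)=\sup_{\pi\in P_t}(\mathcal{E}_\pi u)(x)$ for $t\ge0$, $u\in\mathrm{UC}_\kappa$,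 $x\in M$. Sublinear operator $E$: $E(u+v)\le Eu+Ev$ and $E(cu)=cEu$ for $c>0$. For (possibly nonlinear) semigroups $S,T$ on $\mathrm{UC}_\kappa$ write $S\le T$ if $S(t)u\le T(t)u$ for all $t\ge0$, $u\in\mathrm{UC}_\kappa$. A semigroup $T$ is an upper bound of $(S_\lambda)_{\lambda\in\Lambda}$ if $S_\lambda\le T$ for all $\lambda\in\Lambda$; it is the least upper bound if moreover $T\le T'$ for every other upper bound $T'$. *)

theory Defs
  imports "HOL-Analysis.Analysis"
begin

text \<open>
  The metric space \<open>M\<close> is a type \<open>'a::metric_space\<close>. An operator on \<open>UC\<^sub>\<kappa>\<close> is a total HOL
  function on \<open>'a \<Rightarrow> real\<close>, and a family \<open>(T(t))\<close>, \<open>t \<ge> 0\<close>, is a function of \<open>t :: real\<close>;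
  every condition below only concerns arguments in \<open>UC\<^sub>\<kappa>\<close> and times \<open>t \<ge> 0\<close>.
\<close>

subsection \<open>Norms and function spaces\<close>

text \<open>The norms take values in \<open>[0,\<infinity>]\<close>, so that they are defined for all functions; in particular
  the Lipschitz seminorm of a function that is not Lipschitz is \<open>\<infinity>\<close>.\<close>

definition sup_norm :: "('a \<Rightarrow> real) \<Rightarrow> ennreal" where
  "sup_norm u = (SUP x. ennreal \<bar>u x\<bar>)"

definition weighted_norm :: "('a \<Rightarrow> real) \<Rightarrow> ('a \<Rightarrow> real) \<Rightarrow> ennreal" where
  "weighted_norm \<kappa> u = sup_norm (\<lambda>x. \<kappa> x * u x)"

definition Lip_norm :: "('a::metric_space \<Rightarrow> real) \<Rightarrow> ennreal" where
  "Lip_norm u = (INF L\<in>{L. L-lipschitz_on UNIV u}. ennreal L)"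

definition C_space :: "('a::metric_space \<Rightarrow> real) \<Rightarrow> ('a \<Rightarrow> real) set" where
  "C_space \<kappa> = {u. continuous_on UNIV u \<and> weighted_norm \<kappa> u < \<infinity>}"

definition Lip_b :: "('a::metric_space \<Rightarrow> real) set" where
  "Lip_b = {u. bounded (range u) \<and> (\<exists>L. L-lipschitz_on UNIV u)}"

definition UC :: "('a::metric_space \<Rightarrow> real) \<Rightarrow> ('a \<Rightarrow> real) set" where
  "UC \<kappa> = {u \<in> C_space \<kappa>.
     \<forall>\<epsilon>>0. \<exists>v\<in>Lip_b. weighted_norm \<kappa> (\<lambda>x. v x - u x) < ennreal \<epsilon>}"

subsection \<open>Operators and semigroups\<close>

definition increases_to :: "(nat \<Rightarrow> 'a \<Rightarrow> real) \<Rightarrow> ('a \<Rightarrow> real) \<Rightarrow> bool" where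
  "increases_to U u \<longleftrightarrow> (\<forall>n. U n \<le> U (Suc n)) \<and> (\<forall>x. (\<lambda>n. U n x) \<longlonglongrightarrow> u x)"

definition continuous_op ::
  "('a::metric_space \<Rightarrow> real) \<Rightarrow> (('a \<Rightarrow> real) \<Rightarrow> ('a \<Rightarrow> real)) \<Rightarrow> bool" where
  "continuous_op \<kappa> E \<longleftrightarrow> (\<forall>u\<in>UC \<kappa>. \<forall>\<epsilon>>0. \<exists>\<delta>>0. \<forall>v\<in>UC \<kappa>.
     weighted_norm \<kappa> (\<lambda>x. v x - u x) < ennreal \<delta> \<longrightarrow>
     weighted_norm \<kappa> (\<lambda>x. E v x - E u x) < ennreal \<epsilon>)"

definition monotone_op ::
  "('a::metric_space \<Rightarrow> real) \<Rightarrow> (('a \<Rightarrow> real) \<Rightarrow> ('a \<Rightarrow> real)) \<Rightarrow> bool" where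
  "monotone_op \<kappa> E \<longleftrightarrow> (\<forall>u\<in>UC \<kappa>. \<forall>v\<in>UC \<kappa>. u \<le> v \<longrightarrow> E u \<le> E v)"

definition continuous_from_below ::
  "('a::metric_space \<Rightarrow> real) \<Rightarrow> (('a \<Rightarrow> real) \<Rightarrow> ('a \<Rightarrow> real)) \<Rightarrow> bool" where
  "continuous_from_below \<kappa> E \<longleftrightarrow> (\<forall>U. \<forall>u\<in>UC \<kappa>. (\<forall>n. U n \<in> UC \<kappa>) \<longrightarrow>
     increases_to U u \<longrightarrow> increases_to (\<lambda>n. E (U n)) (E u))"

definition linear_op ::
  "('a::metric_space \<Rightarrow> real) \<Rightarrow> (('a \<Rightarrow> real) \<Rightarrow> ('a \<Rightarrow> real)) \<Rightarrow> bool" where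
  "linear_op \<kappa> E \<longleftrightarrow>
     (\<forall>u\<in>UC \<kappa>. \<forall>v\<in>UC \<kappa>. E (\<lambda>x. u x + v x) = (\<lambda>x. E u x + E v x)) \<and>
     (\<forall>u\<in>UC \<kappa>. \<forall>c. E (\<lambda>x. c * u x) = (\<lambda>x. c * E u x))"

definition sublinear_op ::
  "('a::metric_space \<Rightarrow> real) \<Rightarrow> (('a \<Rightarrow> real) \<Rightarrow> ('a \<Rightarrow> real)) \<Rightarrow> bool" where
  "sublinear_op \<kappa> E \<longleftrightarrow>
     (\<forall>u\<in>UC \<kappa>. \<forall>v\<in>UC \<kappa>. E (\<lambda>x. u x + v x) \<le> (\<lambda>x. E u x + E v x)) \<and>
     (\<forall>u\<in>UC \<kappa>. \<forall>c>0. E (\<lambda>x. c * u x) = (\<lambda>x. c * E u x))"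

definition semigroup_on_UC ::
  "('a::metric_space \<Rightarrow> real) \<Rightarrow> (real \<Rightarrow> ('a \<Rightarrow> real) \<Rightarrow> ('a \<Rightarrow> real)) \<Rightarrow> bool" where
  "semigroup_on_UC \<kappa> T \<longleftrightarrow>
     (\<forall>t\<ge>0. \<forall>u\<in>UC \<kappa>. T t u \<in> UC \<kappa>) \<and>
     (\<forall>u\<in>UC \<kappa>. T 0 u = u) \<and>
     (\<forall>s\<ge>0. \<forall>t\<ge>0. \<forall>u\<in>UC \<kappa>. T (s + t) u = T s (T t u))"

definition Feller_semigroup ::
  "('a::metric_space \<Rightarrow> real) \<Rightarrow> (real \<Rightarrow> ('a \<Rightarrow> real) \<Rightarrow> ('a \<Rightarrow> real)) \<Rightarrow> bool" where
  "Feller_semigroup \<kappa> T \<longleftrightarrow> semigroup_on_UC \<kappa> T \<and>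
     (\<forall>t\<ge>0. continuous_op \<kappa> (T t) \<and> monotone_op \<kappa> (T t) \<and> continuous_from_below \<kappa> (T t))"

subsection \<open>Order on semigroups\<close>

definition semigroup_le ::
  "('a::metric_space \<Rightarrow> real) \<Rightarrow> (real \<Rightarrow> ('a \<Rightarrow> real) \<Rightarrow> ('a \<Rightarrow> real)) \<Rightarrow>
   (real \<Rightarrow> ('a \<Rightarrow> real) \<Rightarrow> ('a \<Rightarrow> real)) \<Rightarrow> bool" where
  "semigroup_le \<kappa> S T \<longleftrightarrow> (\<forall>t\<ge>0. \<forall>u\<in>UC \<kappa>. S t u \<le> T t u)"

text \<open>The upper bounds range over all, possibly nonlinear, semigroups on \<open>UC\<^sub>\<kappa>\<close>, not only over
  Feller semigroups. A Feller semigroup that is least in this larger class is in particular least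
  among the Feller semigroups.\<close>

definition semigroup_upper_bound ::
  "('a::metric_space \<Rightarrow> real) \<Rightarrow> 'l set \<Rightarrow> ('l \<Rightarrow> real \<Rightarrow> ('a \<Rightarrow> real) \<Rightarrow> ('a \<Rightarrow> real)) \<Rightarrow>
   (real \<Rightarrow> ('a \<Rightarrow> real) \<Rightarrow> ('a \<Rightarrow> real)) \<Rightarrow> bool" where
  "semigroup_upper_bound \<kappa> \<Lambda> S T \<longleftrightarrow>
     semigroup_on_UC \<kappa> T \<and> (\<forall>l\<in>\<Lambda>. semigroup_le \<kappa> (S l) T)"

definition semigroup_least_upper_bound ::
  "('a::metric_space \<Rightarrow> real) \<Rightarrow> 'l set \<Rightarrow> ('l \<Rightarrow> real \<Rightarrow> ('a \<Rightarrow> real) \<Rightarrow> ('a \<Rightarrow> real)) \<Rightarrow>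
   (real \<Rightarrow> ('a \<Rightarrow> real) \<Rightarrow> ('a \<Rightarrow> real)) \<Rightarrow> bool" where
  "semigroup_least_upper_bound \<kappa> \<Lambda> S T \<longleftrightarrow> semigroup_upper_bound \<kappa> \<Lambda> S T \<and>
     (\<forall>T'. semigroup_upper_bound \<kappa> \<Lambda> S T' \<longrightarrow> semigroup_le \<kappa> T T')"

subsection \<open>The semigroup envelope\<close>

text \<open>The suprema below are suprema of sets of reals. If \<open>\<Lambda> \<noteq> {}\<close> and the semigroups are linear and
  Feller with \<open>\<parallel>S\<^sub>\<lambda>(t)u\<parallel>\<^sub>\<kappa> \<le> exp (\<alpha> t) \<parallel>u\<parallel>\<^sub>\<kappa>\<close> on bounded Lipschitz functions, hence on \<open>UC\<^sub>\<kappa>\<close> by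
  density, then for \<open>u \<in> UC\<^sub>\<kappa>\<close> and \<open>t \<ge> 0\<close> these sets are nonempty and bounded in absolute value by
  \<open>exp (\<alpha> t) \<parallel>u\<parallel>\<^sub>\<kappa> / \<kappa>(x)\<close>.\<close>

definition E_step ::
  "'l set \<Rightarrow> ('l \<Rightarrow> real \<Rightarrow> ('a \<Rightarrow> real) \<Rightarrow> ('a \<Rightarrow> real)) \<Rightarrow>
   real \<Rightarrow> ('a \<Rightarrow> real) \<Rightarrow> ('a \<Rightarrow> real)" where
  "E_step \<Lambda> S h u = (\<lambda>x. SUP l\<in>\<Lambda>. S l h u x)"

fun E_list ::
  "'l set \<Rightarrow> ('l \<Rightarrow> real \<Rightarrow> ('a \<Rightarrow> real) \<Rightarrow> ('a \<Rightarrow> real)) \<Rightarrow>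
   real list \<Rightarrow> ('a \<Rightarrow> real) \<Rightarrow> ('a \<Rightarrow> real)" where
  "E_list \<Lambda> S (s # t # ts) u = E_step \<Lambda> S (t - s) (E_list \<Lambda> S (t # ts) u)"
| "E_list \<Lambda> S [t] u = u"
| "E_list \<Lambda> S [] u = u"

definition E_part ::
  "'l set \<Rightarrow> ('l \<Rightarrow> real \<Rightarrow> ('a \<Rightarrow> real) \<Rightarrow> ('a \<Rightarrow> real)) \<Rightarrow>
   real set \<Rightarrow> ('a \<Rightarrow> real) \<Rightarrow> ('a \<Rightarrow> real)" where
  "E_part \<Lambda> S \<pi> u = E_list \<Lambda> S (sorted_list_of_set \<pi>) u"

definition partitions :: "real set set" where
  "partitions = {\<pi>. finite \<pi> \<and> \<pi> \<subseteq> {0..} \<and> 0 \<in> \<pi>}"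

definition partitions_upto :: "real \<Rightarrow> real set set" where
  "partitions_upto t = {\<pi> \<in> partitions. Max \<pi> = t}"

definition semigroup_envelope ::
  "'l set \<Rightarrow> ('l \<Rightarrow> real \<Rightarrow> ('a \<Rightarrow> real) \<Rightarrow> ('a \<Rightarrow> real)) \<Rightarrow>
   real \<Rightarrow> ('a \<Rightarrow> real) \<Rightarrow> ('a \<Rightarrow> real)" where
  "semigroup_envelope \<Lambda> S t u = (\<lambda>x. SUP \<pi>\<in>partitions_upto t. E_part \<Lambda> S \<pi> u x)"

end

theory Submission
  imports Defs
begin

text \<open>
  Every linear semigroup of the family satisfies, on \<open>UC \<kappa>\<close>, a list of properties that is closed
  under compositions (with multiplication of the constants) and under pointwise suprema with common
  constants: monotonicity, continuity from below, sublinearity, a Lipschitz bound for the weighted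
  norm, and a bound for the Lipschitz constant and for the supremum of bounded Lipschitz functions.
  These properties are collected in the predicate \<open>admissible\<close>. Since the growth rates are
  exponential in time, a composition of steps along a partition of \<open>[0,t]\<close> has the same constants
  \<open>exp (\<alpha> t)\<close> and \<open>exp (\<beta> t)\<close>, whatever the partition. Hence the supremum over all partitions,
  which is the envelope at time \<open>t\<close>, is admissible too (\<open>envelope_admissible\<close>), and this is
  everything that a Feller semigroup of sublinear operators requires except the semigroup law.

  One half of the semigroup law, that the envelope at time \<open>s + t\<close> lies below the composition of the
  envelopes at times \<open>s\<close> and \<open>t\<close>, holds because refining a partition increases the
  corresponding operator (\<open>step_add_le\<close>), so that \<open>s\<close> may be assumed to be a partition point, where
  the partition can be cut in two. The other half needs the supremum in the inner envelope to be
  exchanged with the outer operators, which are continuous from below along increasing sequences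
  only. By refinement the operators of all partitions are directed. Applied to a bounded Lipschitz
  function they give functions with a common Lipschitz constant, so that on a separable space one
  increasing sequence already exhausts the supremum (\<open>directed_lipschitz_SUP_sequence\<close>). This proves
  the law on bounded Lipschitz functions, and both sides are continuous in the weighted norm, in
  which these functions are dense.

  Finally, an upper bound \<open>T\<close> of the family dominates each single step, hence by monotonicity of the
  steps and the semigroup law for \<open>T\<close> every composition along a partition, and so the envelope.
\<close>

section \<open>Weighted norms and the space of uniform limits of Lipschitz functions\<close>

lemma Lip_norm_le_ennreal_iff:
  assumes "0 \<le> K"
  shows "Lip_norm u \<le> ennreal K \<longleftrightarrow> K-lipschitz_on UNIV u"
proof
  assume le: "Lip_norm u \<le> ennreal K"
  show "K-lipschitz_on UNIV u"
  proof (rule lipschitz_onI)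
    fix x y
    have eps: "dist (u x) (u y) \<le> (K + e) * dist x y" if "0 < e" for e
    proof -
      have "Lip_norm u < ennreal (K + e)"
        using le that assms by (metis add_less_cancel_left add_0_right ennreal_lessI le_less_trans add_strict_increasing2)
      then obtain L where L: "L-lipschitz_on UNIV u" "ennreal L < ennreal (K + e)"
        unfolding Lip_norm_def by (auto simp: INF_less_iff)
      have "L \<le> K + e"
        using L(2) ennreal_less_iff[OF lipschitz_on_nonneg[OF L(1)], of "K + e"] by linarith
      then show ?thesis
        using lipschitz_onD[OF L(1), of x y] by (meson UNIV_I mult_right_mono order_trans zero_le_dist)
    qed
    show "dist (u x) (u y) \<le> K * dist x y"
    proof (rule tendsto_lowerbound)
      show "((\<lambda>e. (K + e) * dist x y) \<longlongrightarrow> K * dist x y) (at_right 0)"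
        by (auto intro!: tendsto_eq_intros)
      show "\<forall>\<^sub>F e in at_right 0. dist (u x) (u y) \<le> (K + e) * dist x y"
        using eps by (auto simp: eventually_at_right_less eventually_at_filter)
    qed simp
  qed (fact assms)
next
  assume "K-lipschitz_on UNIV u"
  then show "Lip_norm u \<le> ennreal K"
    unfolding Lip_norm_def by (intro INF_lower) simp
qed

lemma Lip_b_add:
  assumes "u \<in> Lip_b" "v \<in> Lip_b"
  shows "(\<lambda>x. u x + v x) \<in> Lip_b"
proof -
  have "bounded (range (\<lambda>x. u x + v x))"
    using assms by (auto simp: Lip_b_def intro: bounded_plus_comp)
  with assms show ?thesis
    by (auto simp: Lip_b_def intro: lipschitz_on_add)
qed

lemma Lip_b_cmult:
  assumes "u \<in> Lip_b"
  shows "(\<lambda>x. c * u x) \<in> Lip_b"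
proof -
  have "bounded (range (\<lambda>x. c * u x))"
    using assms bounded_scaling[of "range u" c] by (auto simp: Lip_b_def image_image)
  with assms show ?thesis
    by (auto simp: Lip_b_def intro: lipschitz_on_cmult_real)
qed

lemma Lip_b_const: "(\<lambda>_. c) \<in> Lip_b"
proof -
  have "bounded (range (\<lambda>_::'a. c))" by auto
  then show ?thesis unfolding Lip_b_def using lipschitz_on_constant by blast
qed

lemma Lip_bE:
  assumes "u \<in> Lip_b"
  obtains L B where "L-lipschitz_on UNIV u" "\<And>x. \<bar>u x\<bar> \<le> B"
  using assms unfolding Lip_b_def bounded_iff by auto

lemma Lip_bI:
  assumes "L-lipschitz_on UNIV u" "\<And>x. \<bar>u x\<bar> \<le> B"
  shows "u \<in> Lip_b"
  using assms unfolding Lip_b_def bounded_iff by auto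

locale weight =
  fixes \<kappa> :: "'a::metric_space \<Rightarrow> real"
  assumes kappa_cont: "continuous_on UNIV \<kappa>"
    and kappa_pos: "\<And>x. 0 < \<kappa> x"
    and kappa_bdd: "bounded (range \<kappa>)"
begin

lemma weighted_norm_le_ennreal_iff:
  assumes "0 \<le> B"
  shows "weighted_norm \<kappa> u \<le> ennreal B \<longleftrightarrow> (\<forall>x. \<kappa> x * \<bar>u x\<bar> \<le> B)"
  unfolding weighted_norm_def sup_norm_def SUP_le_iff
  using assms kappa_pos by (simp add: ennreal_le_iff abs_mult less_imp_le)

lemma weighted_bound_nonneg:
  assumes "\<forall>x. \<kappa> x * \<bar>u x\<bar> \<le> B"
  shows "0 \<le> B"
  using assms[rule_format, of undefined] kappa_pos[of undefined]
  by (meson abs_ge_zero mult_nonneg_nonneg less_imp_le order_trans)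

lemma weighted_norm_lessD:
  assumes "weighted_norm \<kappa> u < ennreal B"
  shows "\<forall>x. \<kappa> x * \<bar>u x\<bar> \<le> B"
proof -
  have "0 \<le> B" using assms by (metis ennreal_neg linorder_not_le not_less_zero order_less_imp_le)
  then show ?thesis using assms weighted_norm_le_ennreal_iff[of B u] by (simp add: less_imp_le)
qed

lemma weighted_norm_lessI:
  assumes "\<forall>x. \<kappa> x * \<bar>u x\<bar> \<le> B" "B < C"
  shows "weighted_norm \<kappa> u < ennreal C"
  using assms weighted_bound_nonneg[OF assms(1)] weighted_norm_le_ennreal_iff[of B u]
  by (metis ennreal_lessI le_less_trans)

text \<open>Membership in \<open>UC\<close> needs no separate check of continuity or of a finite norm, since both
  pass to weighted uniform limits of bounded Lipschitz functions: the products with \<open>\<kappa>\<close>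
  converge uniformly, and \<open>\<kappa>\<close> is continuous and positive.\<close>

lemma UC_iff:
  "u \<in> UC \<kappa> \<longleftrightarrow> (\<forall>e>0. \<exists>v\<in>Lip_b. \<forall>x. \<kappa> x * \<bar>v x - u x\<bar> \<le> e)"
proof
  assume "u \<in> UC \<kappa>"
  then show "\<forall>e>0. \<exists>v\<in>Lip_b. \<forall>x. \<kappa> x * \<bar>v x - u x\<bar> \<le> e"
    unfolding UC_def using weighted_norm_lessD by blast
next
  assume approx: "\<forall>e>0. \<exists>v\<in>Lip_b. \<forall>x. \<kappa> x * \<bar>v x - u x\<bar> \<le> e"
  have "\<exists>v. v \<in> Lip_b \<and> (\<forall>x. \<kappa> x * \<bar>v x - u x\<bar> \<le> 1 / real (Suc n))" for n
    using approx[rule_format, of "1 / real (Suc n)"] by auto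
  then obtain V where V: "\<And>n. V n \<in> Lip_b" "\<And>n x. \<kappa> x * \<bar>V n x - u x\<bar> \<le> 1 / real (Suc n)"
    by metis
  have "continuous_on UNIV (\<lambda>x. \<kappa> x * u x)"
  proof (rule uniform_limit_theorem)
    show "\<forall>\<^sub>F n in sequentially. continuous_on UNIV (\<lambda>x. \<kappa> x * V n x)"
      using V(1) by (intro always_eventually allI continuous_on_mult kappa_cont)
        (auto simp: Lip_b_def dest: lipschitz_on_continuous_on)
    show "uniform_limit UNIV (\<lambda>n x. \<kappa> x * V n x) (\<lambda>x. \<kappa> x * u x) sequentially"
    proof (rule uniform_limitI)
      fix e :: real assume "0 < e"
      then obtain N where N: "1 / real (Suc N) < e"
        using nat_approx_posE by blast
      show "\<forall>\<^sub>F n in sequentially. \<forall>x\<in>UNIV. dist (\<kappa> x * V n x) (\<kappa> x * u x) < e"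
      proof (rule eventually_sequentiallyI[of N], intro ballI)
        fix n x assume "N \<le> n"
        have "dist (\<kappa> x * V n x) (\<kappa> x * u x) = \<kappa> x * \<bar>V n x - u x\<bar>"
          using kappa_pos[of x] by (simp add: dist_real_def abs_mult flip: right_diff_distrib)
        also have "\<dots> \<le> 1 / real (Suc n)" by (rule V(2))
        also have "\<dots> \<le> 1 / real (Suc N)" using \<open>N \<le> n\<close> by (simp add: frac_le)
        finally show "dist (\<kappa> x * V n x) (\<kappa> x * u x) < e" using N by simp
      qed
    qed
  qed simp
  then have "continuous_on UNIV (\<lambda>x. (\<kappa> x * u x) / \<kappa> x)"
    using kappa_pos by (intro continuous_on_divide kappa_cont) (auto simp: less_imp_neq[symmetric])
  moreover have "(\<lambda>x. (\<kappa> x * u x) / \<kappa> x) = u"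
    using kappa_pos by (auto simp: less_imp_neq[symmetric])
  ultimately have cont: "continuous_on UNIV u" by (simp only:)
  obtain v where v: "v \<in> Lip_b" "\<forall>x. \<kappa> x * \<bar>v x - u x\<bar> \<le> 1"
    using approx zero_less_one by blast
  obtain L B where B: "\<And>x. \<bar>v x\<bar> \<le> B" using Lip_bE[OF v(1)] by blast
  obtain k where k: "\<And>x. \<kappa> x \<le> k" using kappa_bdd unfolding bounded_iff by (auto dest: abs_le_D1)
  have "\<kappa> x * \<bar>u x\<bar> \<le> k * B + 1" for x
  proof -
    have "\<kappa> x * \<bar>u x\<bar> \<le> \<kappa> x * (\<bar>v x\<bar> + \<bar>v x - u x\<bar>)"
      using kappa_pos[of x] by (intro mult_left_mono) auto
    also have "\<dots> \<le> k * B + 1"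
      unfolding distrib_left using k[of x] B[of x] kappa_pos[of x] v(2)
      by (intro add_mono mult_mono) auto
    finally show ?thesis .
  qed
  then have "weighted_norm \<kappa> u < ennreal (k * B + 1 + 1)"
    by (intro weighted_norm_lessI[of _ "k * B + 1"]) auto
  then have "weighted_norm \<kappa> u < \<infinity>"
    using ennreal_less_top less_trans by fastforce
  moreover have "\<exists>v\<in>Lip_b. weighted_norm \<kappa> (\<lambda>x. v x - u x) < ennreal e" if "e > 0" for e
    using approx[rule_format, of "e / 2"] that weighted_norm_lessI[of _ "e / 2" e]
    by fastforce
  ultimately show "u \<in> UC \<kappa>"
    unfolding UC_def C_space_def using cont by simp
qed

lemma UC_approxE:
  assumes "u \<in> UC \<kappa>" "0 < e"
  obtains v where "v \<in> Lip_b" "\<And>x. \<kappa> x * \<bar>v x - u x\<bar> \<le> e"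
  using assms UC_iff by blast

lemma UC_boundE:
  assumes "u \<in> UC \<kappa>"
  obtains B where "\<forall>x. \<kappa> x * \<bar>u x\<bar> \<le> B"
proof -
  have "weighted_norm \<kappa> u < \<infinity>" using assms by (simp add: UC_def C_space_def)
  then obtain B where "weighted_norm \<kappa> u = ennreal B" "0 \<le> B"
    by (cases "weighted_norm \<kappa> u") auto
  with weighted_norm_le_ennreal_iff[of B u] that show ?thesis by simp
qed

lemma Lip_b_subset_UC: "u \<in> Lip_b \<Longrightarrow> u \<in> UC \<kappa>"
  unfolding UC_iff by (intro allI impI bexI[of _ u]) auto

lemma UC_const: "(\<lambda>_. c) \<in> UC \<kappa>"
  by (intro Lip_b_subset_UC Lip_b_const)

lemma UC_add:
  assumes "u \<in> UC \<kappa>" "v \<in> UC \<kappa>"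
  shows "(\<lambda>x. u x + v x) \<in> UC \<kappa>"
  unfolding UC_iff
proof (intro allI impI)
  fix e :: real assume "0 < e"
  then have e2: "0 < e / 2" by simp
  obtain f where f: "f \<in> Lip_b" "\<And>x. \<kappa> x * \<bar>f x - u x\<bar> \<le> e / 2" using UC_approxE[OF assms(1) e2] by blast
  obtain g where g: "g \<in> Lip_b" "\<And>x. \<kappa> x * \<bar>g x - v x\<bar> \<le> e / 2" using UC_approxE[OF assms(2) e2] by blast
  have "\<kappa> x * \<bar>f x + g x - (u x + v x)\<bar> \<le> e" for x
  proof -
    have "\<kappa> x * \<bar>f x + g x - (u x + v x)\<bar> \<le> \<kappa> x * (\<bar>f x - u x\<bar> + \<bar>g x - v x\<bar>)"
      using kappa_pos[of x] by (intro mult_left_mono) auto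
    also have "\<dots> \<le> e" using f(2)[of x] g(2)[of x] by (simp add: distrib_left)
    finally show ?thesis .
  qed
  then show "\<exists>w\<in>Lip_b. \<forall>x. \<kappa> x * \<bar>w x - (u x + v x)\<bar> \<le> e"
    using Lip_b_add[OF f(1) g(1)] by (intro bexI[of _ "\<lambda>x. f x + g x"]) auto
qed

lemma UC_cmult:
  assumes "u \<in> UC \<kappa>"
  shows "(\<lambda>x. c * u x) \<in> UC \<kappa>"
  unfolding UC_iff
proof (intro allI impI)
  fix e :: real assume "0 < e"
  then have "0 < e / (\<bar>c\<bar> + 1)" by (simp add: add_nonneg_pos)
  then obtain f where f: "f \<in> Lip_b" "\<And>x. \<kappa> x * \<bar>f x - u x\<bar> \<le> e / (\<bar>c\<bar> + 1)"
    using UC_approxE[OF assms] by blast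
  have "\<kappa> x * \<bar>c * f x - c * u x\<bar> \<le> e" for x
  proof -
    have "\<kappa> x * \<bar>c * f x - c * u x\<bar> = \<bar>c\<bar> * (\<kappa> x * \<bar>f x - u x\<bar>)"
      by (simp add: abs_mult flip: right_diff_distrib)
    also have "\<dots> \<le> (\<bar>c\<bar> + 1) * (e / (\<bar>c\<bar> + 1))"
      using f(2)[of x] kappa_pos[of x] by (intro mult_mono) auto
    also have "\<dots> = e" by simp
    finally show ?thesis .
  qed
  then show "\<exists>w\<in>Lip_b. \<forall>x. \<kappa> x * \<bar>w x - c * u x\<bar> \<le> e"
    using Lip_b_cmult[OF f(1)] by (intro bexI[of _ "\<lambda>x. c * f x"]) auto
qed

lemma UC_diff:
  assumes "u \<in> UC \<kappa>" "v \<in> UC \<kappa>"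
  shows "(\<lambda>x. u x - v x) \<in> UC \<kappa>"
  using UC_add[OF assms(1) UC_cmult[OF assms(2), of "-1"]] by simp

end

section \<open>Operators with uniform bounds\<close>

lemma SUP_le_SUP_add:
  fixes f g :: "'i \<Rightarrow> real"
  assumes "I \<noteq> {}" "bdd_above (g ` I)" "\<And>i. i \<in> I \<Longrightarrow> f i \<le> g i + D"
  shows "(SUP i\<in>I. f i) \<le> (SUP i\<in>I. g i) + D"
  using assms(1)
proof (rule cSUP_least)
  fix i assume "i \<in> I"
  then show "f i \<le> (SUP i\<in>I. g i) + D"
    using assms(3)[of i] cSUP_upper[OF _ assms(2), of i] by simp
qed

lemma abs_SUP_diff_le:
  fixes f g :: "'i \<Rightarrow> real"
  assumes "I \<noteq> {}" "bdd_above (f ` I)" "bdd_above (g ` I)" "\<And>i. i \<in> I \<Longrightarrow> \<bar>f i - g i\<bar> \<le> D"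
  shows "\<bar>(SUP i\<in>I. f i) - (SUP i\<in>I. g i)\<bar> \<le> D"
proof -
  have le: "f i \<le> g i + D" "g i \<le> f i + D" if "i \<in> I" for i
    using assms(4)[OF that] by linarith+
  have "(SUP i\<in>I. f i) \<le> (SUP i\<in>I. g i) + D"
    by (intro SUP_le_SUP_add assms le)
  moreover have "(SUP i\<in>I. g i) \<le> (SUP i\<in>I. f i) + D"
    by (intro SUP_le_SUP_add assms le)
  ultimately show ?thesis by linarith
qed

lemma increases_to_le:
  assumes "increases_to U u"
  shows "U n x \<le> u x"
proof -
  have "incseq (\<lambda>n. U n x)"
    using assms by (auto simp: increases_to_def le_fun_def intro: incseq_SucI)
  then show ?thesis
    using assms by (auto simp: increases_to_def intro: incseq_le)
qed

context weight
begin

text \<open>The class of operators in which the whole argument takes place. Each clause is chosen so that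
  it survives both compositions and pointwise suprema of families sharing the constants \<open>C\<close> and
  \<open>K\<close>; this is what carries the properties of the linear semigroups over to the envelope.\<close>

definition admissible :: "real \<Rightarrow> real \<Rightarrow> (('a \<Rightarrow> real) \<Rightarrow> ('a \<Rightarrow> real)) \<Rightarrow> bool" where
  "admissible C K E \<longleftrightarrow> 0 \<le> C \<and>
     (\<forall>u\<in>UC \<kappa>. E u \<in> UC \<kappa>) \<and> monotone_op \<kappa> E \<and> continuous_from_below \<kappa> E \<and> sublinear_op \<kappa> E \<and>
     (\<forall>u\<in>UC \<kappa>. \<forall>v\<in>UC \<kappa>. \<forall>B. (\<forall>x. \<kappa> x * \<bar>u x - v x\<bar> \<le> B) \<longrightarrow>
        (\<forall>x. \<kappa> x * \<bar>E u x - E v x\<bar> \<le> C * B)) \<and>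
     (\<forall>u L B. L-lipschitz_on UNIV u \<longrightarrow> (\<forall>x. \<bar>u x\<bar> \<le> B) \<longrightarrow>
        (K * L)-lipschitz_on UNIV (E u) \<and> (\<forall>x. \<bar>E u x\<bar> \<le> B))"

lemma
  assumes "admissible C K E"
  shows admissible_nonneg: "0 \<le> C"
    and admissible_UC: "u \<in> UC \<kappa> \<Longrightarrow> E u \<in> UC \<kappa>"
    and admissible_mono: "u \<in> UC \<kappa> \<Longrightarrow> v \<in> UC \<kappa> \<Longrightarrow> u \<le> v \<Longrightarrow> E u \<le> E v"
    and admissible_increases_to: "u \<in> UC \<kappa> \<Longrightarrow> (\<And>n. U n \<in> UC \<kappa>) \<Longrightarrow> increases_to U u \<Longrightarrow>
      increases_to (\<lambda>n. E (U n)) (E u)"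
    and admissible_add: "u \<in> UC \<kappa> \<Longrightarrow> v \<in> UC \<kappa> \<Longrightarrow> E (\<lambda>x. u x + v x) y \<le> E u y + E v y"
    and admissible_cmult: "u \<in> UC \<kappa> \<Longrightarrow> 0 < c \<Longrightarrow> E (\<lambda>x. c * u x) = (\<lambda>x. c * E u x)"
    and admissible_diff: "u \<in> UC \<kappa> \<Longrightarrow> v \<in> UC \<kappa> \<Longrightarrow> (\<And>x. \<kappa> x * \<bar>u x - v x\<bar> \<le> B) \<Longrightarrow>
      \<kappa> y * \<bar>E u y - E v y\<bar> \<le> C * B"
    and admissible_lipschitz: "L-lipschitz_on UNIV u \<Longrightarrow> (\<And>x. \<bar>u x\<bar> \<le> B) \<Longrightarrow>
      (K * L)-lipschitz_on UNIV (E u)"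
    and admissible_abs_le: "L-lipschitz_on UNIV u \<Longrightarrow> (\<And>x. \<bar>u x\<bar> \<le> B) \<Longrightarrow> \<bar>E u y\<bar> \<le> B"
  using assms
  by (auto simp: admissible_def monotone_op_def continuous_from_below_def sublinear_op_def le_fun_def)
    (blast+)?

lemma admissible_Lip_b:
  assumes "admissible C K E" "u \<in> Lip_b"
  shows "E u \<in> Lip_b"
  using Lip_bE[OF assms(2)] admissible_lipschitz[OF assms(1)] admissible_abs_le[OF assms(1)] Lip_bI
  by metis

lemma admissible_zero:
  assumes "admissible C K E"
  shows "E (\<lambda>_. 0) = (\<lambda>_. 0)"
  using admissible_abs_le[OF assms, of 0 "\<lambda>_. 0" 0] by (auto intro: lipschitz_on_constant)

lemma admissible_weighted_bound:
  assumes "admissible C K E" "u \<in> UC \<kappa>" "\<And>x. \<kappa> x * \<bar>u x\<bar> \<le> B"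
  shows "\<kappa> x * \<bar>E u x\<bar> \<le> C * B"
  using admissible_diff[OF assms(1,2) UC_const[of 0]] assms(3)
  by (simp add: admissible_zero[OF assms(1)])

text \<open>Stability of \<open>UC\<close> is a consequence of the two quantitative bounds: an operator that is
  Lipschitz in the weighted norm and preserves bounded Lipschitz functions preserves their
  closure.\<close>

lemma UC_closed_under:
  assumes "0 \<le> C"
    and diff: "\<And>u v B x. u \<in> UC \<kappa> \<Longrightarrow> v \<in> UC \<kappa> \<Longrightarrow> (\<forall>x. \<kappa> x * \<bar>u x - v x\<bar> \<le> B) \<Longrightarrow>
      \<kappa> x * \<bar>E u x - E v x\<bar> \<le> C * B"
    and Lip: "\<And>u. u \<in> Lip_b \<Longrightarrow> E u \<in> Lip_b"
    and u: "u \<in> UC \<kappa>"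
  shows "E u \<in> UC \<kappa>"
  unfolding UC_iff
proof (intro allI impI)
  fix e :: real assume "0 < e"
  then have "0 < e / (C + 1)" using \<open>0 \<le> C\<close> by simp
  then obtain v where v: "v \<in> Lip_b" "\<And>x. \<kappa> x * \<bar>v x - u x\<bar> \<le> e / (C + 1)"
    using UC_approxE[OF u] by blast
  have "C * (e / (C + 1)) \<le> e"
    using \<open>0 \<le> C\<close> \<open>0 < e\<close> by (simp add: field_simps)
  then have "\<forall>x. \<kappa> x * \<bar>E v x - E u x\<bar> \<le> e"
    using diff[OF Lip_b_subset_UC[OF v(1)] u] v(2) order_trans by blast
  then show "\<exists>w\<in>Lip_b. \<forall>x. \<kappa> x * \<bar>w x - E u x\<bar> \<le> e"
    using Lip[OF v(1)] by blast
qed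

lemma admissible_continuous_op:
  assumes "admissible C K E"
  shows "continuous_op \<kappa> E"
  unfolding continuous_op_def
proof (intro ballI allI impI)
  fix u and e :: real assume u: "u \<in> UC \<kappa>" and e: "0 < e"
  have C: "0 \<le> C" by (rule admissible_nonneg[OF assms])
  \<comment> \<open>The denominator is positive even if \<open>C = 0\<close>, and it makes the next inequality strict.\<close>
  define d where "d = e / (C + 1)"
  have d: "0 < d" "C * d < e" using C e by (auto simp: d_def field_simps)
  have "weighted_norm \<kappa> (\<lambda>x. E v x - E u x) < ennreal e"
    if v: "v \<in> UC \<kappa>" and "weighted_norm \<kappa> (\<lambda>x. v x - u x) < ennreal d" for v
  proof (rule weighted_norm_lessI[OF _ d(2)], rule allI)
    fix x
    show "\<kappa> x * \<bar>E v x - E u x\<bar> \<le> C * d"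
      using admissible_diff[OF assms v u] weighted_norm_lessD[OF that(2)] by blast
  qed
  with d(1) show "\<exists>\<delta>>0. \<forall>v\<in>UC \<kappa>. weighted_norm \<kappa> (\<lambda>x. v x - u x) < ennreal \<delta> \<longrightarrow>
      weighted_norm \<kappa> (\<lambda>x. E v x - E u x) < ennreal e" by blast
qed

text \<open>An inequality between two such operators extends from the dense set of bounded Lipschitz
  functions to \<open>UC\<close> by continuity.\<close>

lemma le_on_UC_if_le_on_Lip_b:
  assumes E: "admissible C K E" and F: "admissible D L F"
    and le: "\<And>v. v \<in> Lip_b \<Longrightarrow> E v \<le> F v" and u: "u \<in> UC \<kappa>"
  shows "E u \<le> F u"
proof (rule le_funI)
  fix x
  have "\<kappa> x * (E u x - F u x) \<le> (C + D) * e" if e: "0 < e" for e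
  proof -
    obtain v where v: "v \<in> Lip_b" "\<And>x. \<kappa> x * \<bar>v x - u x\<bar> \<le> e"
      using UC_approxE[OF u e] by blast
    have vUC: "v \<in> UC \<kappa>" by (rule Lip_b_subset_UC[OF v(1)])
    have "\<kappa> x * (E u x - F u x) \<le> \<kappa> x * (\<bar>E v x - E u x\<bar> + \<bar>F v x - F u x\<bar>)"
      using kappa_pos[of x] le[OF v(1)] by (intro mult_left_mono) (auto simp: le_fun_def abs_if dest: spec[of _ x])
    also have "\<dots> \<le> C * e + D * e"
      unfolding distrib_left
      by (intro add_mono admissible_diff[OF E vUC u] admissible_diff[OF F vUC u] v(2))
    finally show ?thesis by (simp add: distrib_right)
  qed
  moreover have "((\<lambda>e. (C + D) * e) \<longlongrightarrow> 0) (at_right 0)"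
    by (auto intro!: tendsto_eq_intros)
  ultimately have "\<kappa> x * (E u x - F u x) \<le> 0"
    by (intro tendsto_lowerbound[of "\<lambda>e. (C + D) * e" 0 "at_right 0"])
       (auto simp: eventually_at_filter)
  then show "E u x \<le> F u x"
    using kappa_pos[of x] by (simp add: mult_le_0_iff)
qed

lemma admissible_id: "admissible 1 1 (\<lambda>u. u)"
  by (auto simp: admissible_def monotone_op_def continuous_from_below_def sublinear_op_def le_fun_def)

lemma admissible_compose:
  assumes E: "admissible C K E" and F: "admissible D L F"
  shows "admissible (C * D) (K * L) (\<lambda>u. E (F u))"
  unfolding admissible_def monotone_op_def continuous_from_below_def sublinear_op_def
proof (intro conjI ballI allI impI)
  show "0 \<le> C * D" using admissible_nonneg[OF E] admissible_nonneg[OF F] by simp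
next
  fix u assume "u \<in> UC \<kappa>"
  then show "E (F u) \<in> UC \<kappa>" using admissible_UC[OF E] admissible_UC[OF F] by blast
next
  fix u v assume "u \<in> UC \<kappa>" "v \<in> UC \<kappa>" "u \<le> v"
  then show "E (F u) \<le> E (F v)"
    by (intro admissible_mono[OF E] admissible_mono[OF F] admissible_UC[OF F])
next
  fix U u assume "u \<in> UC \<kappa>" "\<forall>n. U n \<in> UC \<kappa>" "increases_to U u"
  then show "increases_to (\<lambda>n. E (F (U n))) (E (F u))"
    by (intro admissible_increases_to[OF E] admissible_increases_to[OF F] admissible_UC[OF F]) auto
next
  fix u v assume uv: "u \<in> UC \<kappa>" "v \<in> UC \<kappa>"
  have "E (F (\<lambda>x. u x + v x)) \<le> E (\<lambda>x. F u x + F v x)"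
    using uv by (intro admissible_mono[OF E] admissible_UC[OF F] UC_add) (auto simp: le_fun_def intro: admissible_add[OF F])
  also have "\<dots> \<le> (\<lambda>x. E (F u) x + E (F v) x)"
    using uv by (auto simp: le_fun_def intro!: admissible_add[OF E] admissible_UC[OF F])
  finally show "E (F (\<lambda>x. u x + v x)) \<le> (\<lambda>x. E (F u) x + E (F v) x)" .
next
  fix u and c :: real assume "u \<in> UC \<kappa>" "0 < c"
  then show "E (F (\<lambda>x. c * u x)) = (\<lambda>x. c * E (F u) x)"
    by (simp add: admissible_cmult[OF E] admissible_cmult[OF F] admissible_UC[OF F])
next
  fix u v B x assume "u \<in> UC \<kappa>" "v \<in> UC \<kappa>" "\<forall>x. \<kappa> x * \<bar>u x - v x\<bar> \<le> B"
  then show "\<kappa> x * \<bar>E (F u) x - E (F v) x\<bar> \<le> C * D * B"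
    unfolding mult.assoc
    by (intro admissible_diff[OF E] admissible_diff[OF F] admissible_UC[OF F]) auto
next
  fix u :: "'a \<Rightarrow> real" and M B assume u: "M-lipschitz_on UNIV u" "\<forall>x. \<bar>u x\<bar> \<le> B"
  have Fu: "(L * M)-lipschitz_on UNIV (F u)" "\<And>x. \<bar>F u x\<bar> \<le> B"
    using admissible_lipschitz[OF F u(1)] admissible_abs_le[OF F u(1)] u(2) by auto
  show "(K * L * M)-lipschitz_on UNIV (E (F u))"
    using admissible_lipschitz[OF E Fu] by (simp add: mult.assoc)
  fix x show "\<bar>E (F u) x\<bar> \<le> B" by (rule admissible_abs_le[OF E Fu])
qed

lemma admissible_family_bdd_above:
  assumes "\<And>i. i \<in> I \<Longrightarrow> admissible C K (E i)" "u \<in> UC \<kappa>"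
  shows "bdd_above ((\<lambda>i. E i u x) ` I)"
proof -
  obtain B where B: "\<forall>x. \<kappa> x * \<bar>u x\<bar> \<le> B" using UC_boundE[OF assms(2)] by blast
  have "E i u x \<le> C * B / \<kappa> x" if "i \<in> I" for i
  proof -
    have "\<kappa> x * \<bar>E i u x\<bar> \<le> C * B"
      using admissible_weighted_bound[OF assms(1)[OF that] assms(2)] B by blast
    then have "\<bar>E i u x\<bar> \<le> C * B / \<kappa> x"
      using kappa_pos[of x] by (simp add: field_simps)
    then show ?thesis by simp
  qed
  then show ?thesis by (auto intro!: bdd_aboveI)
qed

text \<open>Continuity from below survives because the limit along an increasing sequence is itself a
  supremum and suprema commute. For the quantitative clauses it matters that all members share the
  constants, since the difference of two suprema is at most the largest difference of
  corresponding terms.\<close>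

lemma admissible_SUP:
  assumes ne: "I \<noteq> {}" and adm: "\<And>i. i \<in> I \<Longrightarrow> admissible C K (E i)"
  shows "admissible C K (\<lambda>u x. SUP i\<in>I. E i u x)"
proof -
  let ?E = "\<lambda>u x. SUP i\<in>I. E i u x"
  obtain i0 where i0: "i0 \<in> I" using ne by blast
  have bdd: "bdd_above ((\<lambda>i. E i u x) ` I)" if "u \<in> UC \<kappa>" for u x
    using admissible_family_bdd_above[OF adm that] .
  have upper: "E i u x \<le> ?E u x" if "i \<in> I" "u \<in> UC \<kappa>" for i u x
    using cSUP_upper[OF that(1) bdd[OF that(2)]] by simp
  have C: "0 \<le> C" by (rule admissible_nonneg[OF adm[OF i0]])
  have mono: "?E u \<le> ?E v" if "u \<in> UC \<kappa>" "v \<in> UC \<kappa>" "u \<le> v" for u v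
  proof (rule le_funI, rule cSUP_mono[OF ne bdd[OF that(2)]])
    fix x i assume "i \<in> I"
    then show "\<exists>j\<in>I. E i u x \<le> E j v x"
      using admissible_mono[OF adm that] by (auto simp: le_fun_def)
  qed
  have diff: "\<kappa> x * \<bar>?E u x - ?E v x\<bar> \<le> C * B"
    if uv: "u \<in> UC \<kappa>" "v \<in> UC \<kappa>" and B: "\<forall>x. \<kappa> x * \<bar>u x - v x\<bar> \<le> B" for u v B x
  proof -
    have "\<bar>?E u x - ?E v x\<bar> \<le> C * B / \<kappa> x"
    proof (rule abs_SUP_diff_le[OF ne bdd[OF uv(1)] bdd[OF uv(2)]])
      fix i assume "i \<in> I"
      then have "\<kappa> x * \<bar>E i u x - E i v x\<bar> \<le> C * B"
        using admissible_diff[OF adm uv] B by blast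
      then show "\<bar>E i u x - E i v x\<bar> \<le> C * B / \<kappa> x"
        using kappa_pos[of x] by (simp add: field_simps)
    qed
    then show ?thesis using kappa_pos[of x] by (simp add: field_simps)
  qed
  have Lip: "(K * L)-lipschitz_on UNIV (?E u)" and abs: "\<bar>?E u x\<bar> \<le> B"
    if u: "L-lipschitz_on UNIV u" "\<forall>x. \<bar>u x\<bar> \<le> B" for u :: "'a \<Rightarrow> real" and L B x
  proof -
    have uUC: "u \<in> UC \<kappa>" using Lip_b_subset_UC Lip_bI[OF u(1)] u(2) by blast
    show "(K * L)-lipschitz_on UNIV (?E u)"
    proof (rule lipschitz_onI)
      fix x y
      have "\<bar>?E u x - ?E u y\<bar> \<le> K * L * dist x y"
      proof (rule abs_SUP_diff_le[OF ne bdd[OF uUC] bdd[OF uUC]])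
        fix i assume "i \<in> I"
        then show "\<bar>E i u x - E i u y\<bar> \<le> K * L * dist x y"
          using lipschitz_onD[OF admissible_lipschitz[OF adm u(1)]] u(2) by (auto simp: dist_real_def)
      qed
      then show "dist (?E u x) (?E u y) \<le> K * L * dist x y" by (simp add: dist_real_def)
    next
      show "0 \<le> K * L"
        using lipschitz_on_nonneg[OF admissible_lipschitz[OF adm[OF i0] u(1)]] u(2) by blast
    qed
    have "\<bar>E i u x\<bar> \<le> B" if "i \<in> I" for i
      using admissible_abs_le[OF adm[OF that] u(1)] u(2) by blast
    then show "\<bar>?E u x\<bar> \<le> B"
      using abs_SUP_diff_le[OF ne bdd[OF uUC] bdd[OF UC_const[of 0]], of x x B]
      by (simp add: admissible_zero[OF adm] ne cong: SUP_cong_simp)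
  qed
  have below: "increases_to (\<lambda>n. ?E (U n)) (?E u)"
    if u: "u \<in> UC \<kappa>" and U: "\<And>n. U n \<in> UC \<kappa>" and inc: "increases_to U u" for U u
    unfolding increases_to_def
  proof (intro conjI allI)
    fix n show "?E (U n) \<le> ?E (U (Suc n))"
      using inc by (intro mono U) (simp add: increases_to_def)
  next
    fix x
    show "(\<lambda>n. ?E (U n) x) \<longlonglongrightarrow> ?E u x"
    proof (rule order_tendstoI)
      fix a assume "a < ?E u x"
      then obtain i where i: "i \<in> I" "a < E i u x"
        using less_cSUP_iff[OF ne bdd[OF u]] by blast
      have "(\<lambda>n. E i (U n) x) \<longlonglongrightarrow> E i u x"
        using admissible_increases_to[OF adm[OF i(1)] u U inc] by (simp add: increases_to_def)
      then have "\<forall>\<^sub>F n in sequentially. a < E i (U n) x"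
        using i(2) by (rule order_tendstoD)
      then show "\<forall>\<^sub>F n in sequentially. a < ?E (U n) x"
        by (rule eventually_mono) (use upper[OF i(1) U] less_le_trans in blast)
    next
      fix a assume "?E u x < a"
      moreover have "?E (U n) x \<le> ?E u x" for n
        using mono[OF U u, of n] increases_to_le[OF inc] by (auto simp: le_fun_def)
      ultimately show "\<forall>\<^sub>F n in sequentially. ?E (U n) x < a"
        using le_less_trans by (intro always_eventually) blast
    qed
  qed
  have add: "?E (\<lambda>x. u x + v x) \<le> (\<lambda>x. ?E u x + ?E v x)" if uv: "u \<in> UC \<kappa>" "v \<in> UC \<kappa>" for u v
  proof (rule le_funI, rule cSUP_least[OF ne])
    fix x i assume "i \<in> I"
    then show "E i (\<lambda>x. u x + v x) x \<le> ?E u x + ?E v x"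
      using admissible_add[OF adm uv, of i x] upper[OF _ uv(1), of i x] upper[OF _ uv(2), of i x]
      by linarith
  qed
  have cmult: "?E (\<lambda>x. c * u x) = (\<lambda>x. c * ?E u x)" if u: "u \<in> UC \<kappa>" and c: "0 < c" for u and c :: real
  proof
    fix x
    have "?E (\<lambda>x. c * u x) x = (SUP i\<in>I. c * E i u x)"
      using admissible_cmult[OF adm u c] by (intro SUP_cong) auto
    also have "\<dots> = c * ?E u x"
    proof -
      have "continuous (at_left y) (\<lambda>y. c * y)" for y :: real
        by (intro continuous_intros)
      then show ?thesis
        using continuous_at_Sup_mono[of "\<lambda>y. c * y" "(\<lambda>i. E i u x) ` I"] ne bdd[OF u] c
        by (auto simp: mono_def image_image)
    qed
    finally show "?E (\<lambda>x. c * u x) x = c * ?E u x" .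
  qed
  have "?E u \<in> UC \<kappa>" if "u \<in> UC \<kappa>" for u
  proof (rule UC_closed_under[OF C diff _ that])
    fix v :: "'a \<Rightarrow> real" assume "v \<in> Lip_b"
    then show "?E v \<in> Lip_b" using Lip_bE Lip abs Lip_bI by (metis (no_types, lifting))
  qed
  note UC = this
  show ?thesis
    unfolding admissible_def monotone_op_def continuous_from_below_def sublinear_op_def
    by (intro conjI ballI allI impI; (rule C UC mono diff Lip abs below add cmult; simp))
qed

end

section \<open>Suprema of directed equi-Lipschitz families\<close>

text \<open>On a countable dense set, directedness allows to choose, one after the other, members of the
  family that are above all previously chosen ones and almost optimal at more and more points. The
  common Lipschitz constant carries convergence from the dense set to the whole space; without it
  the limit of the sequence could be smaller than the supremum off the dense set.\<close>

lemma directed_lipschitz_SUP_sequence: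
  fixes f :: "'i \<Rightarrow> 'a::metric_space \<Rightarrow> real"
  assumes sep: "separable_space (euclidean :: 'a topology)"
    and ne: "I \<noteq> {}"
    and lip: "\<And>i. i \<in> I \<Longrightarrow> K-lipschitz_on UNIV (f i)"
    and bdd: "\<And>x. bdd_above ((\<lambda>i. f i x) ` I)"
    and dir: "\<And>i j. i \<in> I \<Longrightarrow> j \<in> I \<Longrightarrow> \<exists>k\<in>I. f i \<le> f k \<and> f j \<le> f k"
  obtains s where "\<And>n. s n \<in> I" "increases_to (\<lambda>n. f (s n)) (\<lambda>x. SUP i\<in>I. f i x)"
proof -
  let ?g = "\<lambda>x. SUP i\<in>I. f i x"
  obtain D :: "'a set" where D: "countable D" "closure D = UNIV"
    using sep by (auto simp: separable_space_def euclidean_closure_of)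
  then have "D \<noteq> {}" by auto
  define d where "d = from_nat_into D"
  have range_d: "range d = D"
    unfolding d_def by (rule range_from_nat_into[OF \<open>D \<noteq> {}\<close> D(1)])
  obtain i0 where i0: "i0 \<in> I" using ne by blast
  have K: "0 \<le> K" using lipschitz_on_nonneg[OF lip[OF i0]] .
  have upper: "f i x \<le> ?g x" if "i \<in> I" for i x
    by (rule cSUP_upper[OF that bdd])
  have step: "\<exists>j\<in>I. f i \<le> f j \<and> (\<forall>k<n. ?g (d k) - e < f j (d k))"
    if i: "i \<in> I" and e: "0 < e" for i and n :: nat and e :: real
  proof (induction n)
    case 0
    then show ?case using i by auto
  next
    case (Suc n)
    then obtain j where j: "j \<in> I" "f i \<le> f j" "\<And>k. k < n \<Longrightarrow> ?g (d k) - e < f j (d k)" by auto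
    have "?g (d n) - e < ?g (d n)" using e by simp
    then obtain j' where j': "j' \<in> I" "?g (d n) - e < f j' (d n)"
      using less_cSUP_iff[OF ne bdd] by blast
    obtain m where m: "m \<in> I" "f j \<le> f m" "f j' \<le> f m" using dir[OF j(1) j'(1)] by blast
    have "?g (d k) - e < f m (d k)" if "k < Suc n" for k
    proof (cases "k = n")
      case True
      then show ?thesis using j'(2) m(3) by (auto simp: le_fun_def intro: less_le_trans)
    next
      case False
      then show ?thesis using j(3)[of k] m(2) that by (auto simp: le_fun_def intro: less_le_trans)
    qed
    then show ?case using m(1) order_trans[OF j(2) m(2)] by blast
  qed
  have "\<exists>s. \<forall>n. (s n \<in> I \<and> (\<forall>k<n. ?g (d k) - 1 / real (Suc n) < f (s n) (d k))) \<and>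
      f (s n) \<le> f (s (Suc n))"
  proof (rule dependent_nat_choice)
    show "\<exists>i. i \<in> I \<and> (\<forall>k<0. ?g (d k) - 1 / real (Suc 0) < f i (d k))" using i0 by auto
  next
    fix i n assume "i \<in> I \<and> (\<forall>k<n. ?g (d k) - 1 / real (Suc n) < f i (d k))"
    then show "\<exists>j. (j \<in> I \<and> (\<forall>k<Suc n. ?g (d k) - 1 / real (Suc (Suc n)) < f j (d k))) \<and> f i \<le> f j"
      using step[of i "1 / real (Suc (Suc n))" "Suc n"] by auto
  qed
  then obtain s where s: "\<And>n. s n \<in> I" "\<And>n. f (s n) \<le> f (s (Suc n))"
    and near: "\<And>n k. k < n \<Longrightarrow> ?g (d k) - 1 / real (Suc n) < f (s n) (d k)"
    by blast
  have g_lip: "\<bar>?g x - ?g y\<bar> \<le> K * dist x y" for x y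
    using lipschitz_onD[OF lip] by (intro abs_SUP_diff_le ne bdd) (auto simp: dist_real_def)
  have "(\<lambda>n. f (s n) x) \<longlonglongrightarrow> ?g x" for x
  proof (rule LIMSEQ_I)
    fix e :: real assume e: "0 < e"
    have "0 < e / (3 * (K + 1))" using e K by simp
    then obtain y where "y \<in> D" and y: "dist y x < e / (3 * (K + 1))"
      using D(2) closure_approachable[of x D] by auto
    then obtain k where k: "y = d k" using range_d by auto
    \<comment> \<open>The distance from \<open>x\<close> to \<open>y\<close> is paid twice, once for \<open>f (s n)\<close> and once for the supremum; the
      last third of \<open>e\<close> is the defect at \<open>y\<close>.\<close>
    have Ky: "K * dist x y < e / 3"
    proof -
      have "K * dist x y \<le> (K + 1) * dist x y" by (intro mult_right_mono) auto
      also have "\<dots> < e / 3" using y K by (simp add: dist_commute field_simps)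
      finally show ?thesis .
    qed
    obtain N where N: "1 / real (Suc N) < e / 3" using nat_approx_posE[of "e / 3"] e by auto
    show "\<exists>N. \<forall>n\<ge>N. norm (f (s n) x - ?g x) < e"
    proof (intro exI[of _ "max (Suc k) N"] allI impI)
      fix n assume n: "max (Suc k) N \<le> n"
      have "1 / real (Suc n) \<le> 1 / real (Suc N)" using n by (simp add: frac_le)
      then have "?g y - e / 3 < f (s n) y" using near[of k n] n N k by simp
      moreover have "\<bar>f (s n) x - f (s n) y\<bar> \<le> K * dist x y"
        using lipschitz_onD[OF lip[OF s(1)]] by (auto simp: dist_real_def)
      ultimately have "?g x - e < f (s n) x"
        using g_lip[of x y] Ky by linarith
      then show "norm (f (s n) x - ?g x) < e"
        using upper[OF s(1), of n x] by simp
    qed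
  qed
  with s show ?thesis by (intro that[of s]) (auto simp: increases_to_def)
qed

section \<open>Partitions\<close>

text \<open>Cutting a list of times repeats the cut point as last time of the first part and first time of
  the second one, because the operator depends on the differences of consecutive times.\<close>

lemma E_list_append:
  "E_list \<Lambda> S (xs @ a # ys) u = E_list \<Lambda> S (xs @ [a]) (E_list \<Lambda> S (a # ys) u)"
proof (induction xs)
  case Nil
  then show ?case by simp
next
  case (Cons x xs)
  then show ?case by (cases xs) auto
qed

lemma E_list_shift: "E_list \<Lambda> S (map ((+) c) xs) u = E_list \<Lambda> S xs u"
  by (induction xs u rule: E_list.induct[of _ \<Lambda> S]) (auto simp: algebra_simps)

lemma partitions_uptoI:
  assumes "finite \<pi>" "\<pi> \<subseteq> {0..t}" "0 \<in> \<pi>" "t \<in> \<pi>"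
  shows "\<pi> \<in> partitions_upto t"
proof -
  have "Max \<pi> = t" using assms by (intro Max_eqI) auto
  with assms show ?thesis by (auto simp: partitions_upto_def partitions_def)
qed

lemma partitions_uptoD:
  assumes "\<pi> \<in> partitions_upto t"
  shows "finite \<pi>" "\<pi> \<subseteq> {0..t}" "0 \<in> \<pi>" "t \<in> \<pi>"
  using assms Max_in[of \<pi>] Max_ge[of \<pi>] by (auto simp: partitions_upto_def partitions_def)

lemma partitions_upto_zero: "partitions_upto 0 = {{0}}"
proof
  show "partitions_upto 0 \<subseteq> {{0}}" using partitions_uptoD[of _ 0] by fastforce
  show "{{0}} \<subseteq> partitions_upto 0" by (auto intro: partitions_uptoI)
qed

lemma partitions_upto_trivial: "0 \<le> t \<Longrightarrow> {0, t} \<in> partitions_upto t"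
  by (auto intro: partitions_uptoI)

lemma partitions_upto_Un:
  assumes "\<pi> \<in> partitions_upto t" "finite \<rho>" "\<rho> \<subseteq> {0..t}"
  shows "\<pi> \<union> \<rho> \<in> partitions_upto t"
  using partitions_uptoD[OF assms(1)] assms(2,3) by (intro partitions_uptoI) auto

lemma sorted_list_of_partition:
  assumes "\<pi> \<in> partitions_upto t"
  defines "xs \<equiv> sorted_list_of_set \<pi>"
  shows "xs \<noteq> []" "sorted xs" "hd xs = 0" "last xs = t"
proof -
  note \<pi> = partitions_uptoD[OF assms(1)]
  have set: "set xs = \<pi>" using \<pi>(1) by (simp add: xs_def)
  show ne: "xs \<noteq> []" using set \<pi>(3) by auto
  show sorted: "sorted xs" by (simp add: xs_def)
  have "hd xs \<in> \<pi>" "last xs \<in> \<pi>" using set ne by auto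
  moreover have "hd xs \<le> 0"
    using sorted ne set \<pi>(3) by (cases xs) auto
  moreover have "t \<le> last xs"
    using sorted ne set \<pi>(4) by (cases xs rule: rev_cases) (auto simp: sorted_append)
  ultimately show "hd xs = 0" "last xs = t" using \<pi>(2) by fastforce+
qed

lemma partition_concat:
  assumes p: "\<pi> \<in> partitions_upto s" and r: "\<rho> \<in> partitions_upto t"
  shows partitions_upto_concat: "\<pi> \<union> (+) s ` \<rho> \<in> partitions_upto (s + t)"
    and E_part_concat: "E_part \<Lambda> S (\<pi> \<union> (+) s ` \<rho>) u = E_part \<Lambda> S \<pi> (E_part \<Lambda> S \<rho> u)"
proof -
  note P = partitions_uptoD[OF p] and R = partitions_uptoD[OF r]
  have "0 \<le> s" "0 \<le> t" using P R by auto
  then show "\<pi> \<union> (+) s ` \<rho> \<in> partitions_upto (s + t)"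
    using P R by (intro partitions_uptoI) auto
  define xs ys where "xs = sorted_list_of_set \<pi>" and "ys = sorted_list_of_set \<rho>"
  note X = sorted_list_of_partition[OF p, folded xs_def] and Y = sorted_list_of_partition[OF r, folded ys_def]
  obtain xs' where xs: "xs = xs' @ [s]" using X by (metis append_butlast_last_id)
  obtain ys' where ys: "ys = 0 # ys'" using Y by (metis list.collapse)
  have set: "set xs = \<pi>" "set ys = \<rho>" using P(1) R(1) by (auto simp: xs_def ys_def)
  have strict: "sorted_wrt (<) xs" "sorted_wrt (<) ys" by (simp_all add: xs_def ys_def)
  have "sorted_wrt (<) (xs' @ s # map ((+) s) ys')"
    using strict unfolding xs ys
    by (auto simp: sorted_wrt_append sorted_wrt_map intro: less_trans[OF _ less_add_same_cancel1[THEN iffD2]])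
  moreover have "set (xs' @ s # map ((+) s) ys') = \<pi> \<union> (+) s ` \<rho>"
    using set unfolding xs ys by auto
  ultimately have "sorted_list_of_set (\<pi> \<union> (+) s ` \<rho>) = xs' @ s # map ((+) s) ys'"
    using P(1) R(1) by (intro strict_sorted_equal) auto
  then have "E_part \<Lambda> S (\<pi> \<union> (+) s ` \<rho>) u = E_list \<Lambda> S (xs' @ s # map ((+) s) ys') u"
    unfolding E_part_def by (simp only:)
  also have "\<dots> = E_list \<Lambda> S (xs' @ [s]) (E_list \<Lambda> S (s # map ((+) s) ys') u)"
    by (rule E_list_append)
  also have "\<dots> = E_list \<Lambda> S xs (E_list \<Lambda> S (map ((+) s) ys) u)"
    unfolding xs ys by simp
  finally have "E_part \<Lambda> S (\<pi> \<union> (+) s ` \<rho>) u = E_list \<Lambda> S xs (E_list \<Lambda> S (map ((+) s) ys) u)" .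
  then show "E_part \<Lambda> S (\<pi> \<union> (+) s ` \<rho>) u = E_part \<Lambda> S \<pi> (E_part \<Lambda> S \<rho> u)"
    unfolding E_list_shift E_part_def xs_def ys_def .
qed

lemma partition_split:
  assumes p: "\<pi> \<in> partitions_upto (s + t)" and s: "s \<in> \<pi>"
  obtains \<pi>1 \<pi>2 where "\<pi>1 \<in> partitions_upto s" "\<pi>2 \<in> partitions_upto t" "\<pi> = \<pi>1 \<union> (+) s ` \<pi>2"
proof
  note P = partitions_uptoD[OF p]
  have "0 \<le> s" "0 \<le> t" using P s by auto
  then show "{x \<in> \<pi>. x \<le> s} \<in> partitions_upto s"
    using P s by (intro partitions_uptoI) auto
  show "(\<lambda>x. x - s) ` {x \<in> \<pi>. s \<le> x} \<in> partitions_upto t"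
  proof (rule partitions_uptoI)
    show "0 \<in> (\<lambda>x. x - s) ` {x \<in> \<pi>. s \<le> x}" using s by force
    show "t \<in> (\<lambda>x. x - s) ` {x \<in> \<pi>. s \<le> x}" using P(4) \<open>0 \<le> t\<close> by (intro image_eqI[of _ _ "s + t"]) auto
  qed (use P in auto)
  show "\<pi> = {x \<in> \<pi>. x \<le> s} \<union> (+) s ` (\<lambda>x. x - s) ` {x \<in> \<pi>. s \<le> x}"
    by (auto simp: image_image)
qed

section \<open>The semigroup envelope\<close>

locale linear_semigroup_family = weight \<kappa> for \<kappa> :: "'a::metric_space \<Rightarrow> real" +
  fixes \<Lambda> :: "'l set"
    and S :: "'l \<Rightarrow> real \<Rightarrow> ('a \<Rightarrow> real) \<Rightarrow> ('a \<Rightarrow> real)"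
    and \<alpha> \<beta> :: real
  assumes separable: "separable_space (euclidean :: 'a topology)"
    and nonempty: "\<Lambda> \<noteq> {}"
    and Feller: "\<And>l. l \<in> \<Lambda> \<Longrightarrow> Feller_semigroup \<kappa> (S l)"
    and linear: "\<And>l t. l \<in> \<Lambda> \<Longrightarrow> 0 \<le> t \<Longrightarrow> linear_op \<kappa> (S l t)"
    and one: "\<And>l t. l \<in> \<Lambda> \<Longrightarrow> 0 \<le> t \<Longrightarrow> S l t (\<lambda>_. 1) = (\<lambda>_. 1)"
    and norm_growth: "\<And>l t u. l \<in> \<Lambda> \<Longrightarrow> 0 \<le> t \<Longrightarrow> u \<in> Lip_b \<Longrightarrow>
      weighted_norm \<kappa> (S l t u) \<le> ennreal (exp (\<alpha> * t)) * weighted_norm \<kappa> u"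
    and Lip_growth: "\<And>l t u. l \<in> \<Lambda> \<Longrightarrow> 0 \<le> t \<Longrightarrow> u \<in> Lip_b \<Longrightarrow>
      Lip_norm (S l t u) \<le> ennreal (exp (\<beta> * t)) * Lip_norm u"
begin

abbreviation "step \<equiv> E_step \<Lambda> S"
abbreviation "envelope \<equiv> semigroup_envelope \<Lambda> S"

lemma
  assumes "l \<in> \<Lambda>"
  shows S_UC: "0 \<le> t \<Longrightarrow> u \<in> UC \<kappa> \<Longrightarrow> S l t u \<in> UC \<kappa>"
    and S_zero: "u \<in> UC \<kappa> \<Longrightarrow> S l 0 u = u"
    and S_add_time: "0 \<le> s \<Longrightarrow> 0 \<le> t \<Longrightarrow> u \<in> UC \<kappa> \<Longrightarrow> S l (s + t) u = S l s (S l t u)"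
    and S_continuous: "0 \<le> t \<Longrightarrow> continuous_op \<kappa> (S l t)"
    and S_monotone: "0 \<le> t \<Longrightarrow> monotone_op \<kappa> (S l t)"
    and S_below: "0 \<le> t \<Longrightarrow> continuous_from_below \<kappa> (S l t)"
  using Feller[OF assms] unfolding Feller_semigroup_def semigroup_on_UC_def by blast+

lemma
  assumes "l \<in> \<Lambda>" "0 \<le> t" "u \<in> UC \<kappa>"
  shows S_add: "v \<in> UC \<kappa> \<Longrightarrow> S l t (\<lambda>x. u x + v x) = (\<lambda>x. S l t u x + S l t v x)"
    and S_cmult: "S l t (\<lambda>x. c * u x) = (\<lambda>x. c * S l t u x)"
  using linear[OF assms(1,2)] assms(3) unfolding linear_op_def by blast+

lemma S_diff:
  assumes "l \<in> \<Lambda>" "0 \<le> t" "u \<in> UC \<kappa>" "v \<in> UC \<kappa>"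
  shows "S l t (\<lambda>x. u x - v x) = (\<lambda>x. S l t u x - S l t v x)"
  using S_add[OF assms(1-3) UC_cmult[OF assms(4), of "-1"]] S_cmult[OF assms(1,2,4), of "-1"]
  by simp

lemma S_weighted_bound_Lip_b:
  assumes "l \<in> \<Lambda>" "0 \<le> t" "u \<in> Lip_b" "\<And>x. \<kappa> x * \<bar>u x\<bar> \<le> B"
  shows "\<kappa> x * \<bar>S l t u x\<bar> \<le> exp (\<alpha> * t) * B"
proof -
  have B: "0 \<le> B" using assms(4) weighted_bound_nonneg by blast
  then have "weighted_norm \<kappa> u \<le> ennreal B" using weighted_norm_le_ennreal_iff assms(4) by blast
  then have "weighted_norm \<kappa> (S l t u) \<le> ennreal (exp (\<alpha> * t)) * ennreal B"
    using norm_growth[OF assms(1-3)] by (meson mult_left_mono order_trans zero_le)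
  also have "\<dots> = ennreal (exp (\<alpha> * t) * B)" using B by (simp add: ennreal_mult)
  finally show ?thesis using weighted_norm_le_ennreal_iff[of "exp (\<alpha> * t) * B"] B by simp
qed

text \<open>The growth bound is assumed on bounded Lipschitz functions only; it extends to their closure
  by continuity of the operator.\<close>

lemma S_weighted_bound:
  assumes l: "l \<in> \<Lambda>" and t: "0 \<le> t" and u: "u \<in> UC \<kappa>" and B: "\<And>x. \<kappa> x * \<bar>u x\<bar> \<le> B"
  shows "\<kappa> x * \<bar>S l t u x\<bar> \<le> exp (\<alpha> * t) * B"
proof -
  have "\<kappa> x * \<bar>S l t u x\<bar> \<le> exp (\<alpha> * t) * (B + e) + e" if e: "0 < e" for e
  proof -
    obtain d where d: "0 < d" and close: "\<And>v. v \<in> UC \<kappa> \<Longrightarrow>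
        weighted_norm \<kappa> (\<lambda>x. v x - u x) < ennreal d \<Longrightarrow>
        weighted_norm \<kappa> (\<lambda>x. S l t v x - S l t u x) < ennreal e"
      using S_continuous[OF l t] u e unfolding continuous_op_def by blast
    \<comment> \<open>Half of \<open>d\<close>, because \<open>d\<close> bounds the weighted norm strictly; \<open>e\<close> keeps the norm of \<open>v\<close> close
      to that of \<open>u\<close>.\<close>
    have "0 < min (d / 2) e" using d e by simp
    then obtain v where v: "v \<in> Lip_b" "\<And>x. \<kappa> x * \<bar>v x - u x\<bar> \<le> min (d / 2) e"
      using UC_approxE[OF u] by blast
    have "weighted_norm \<kappa> (\<lambda>x. v x - u x) < ennreal d"
      by (rule weighted_norm_lessI[of _ "min (d / 2) e"]) (use v(2) d in auto)
    then have Svu: "\<kappa> x * \<bar>S l t v x - S l t u x\<bar> \<le> e"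
      using weighted_norm_lessD[OF close[OF Lip_b_subset_UC[OF v(1)]]] by blast
    have "\<kappa> y * \<bar>v y\<bar> \<le> B + e" for y
    proof -
      have "\<kappa> y * \<bar>v y\<bar> \<le> \<kappa> y * (\<bar>u y\<bar> + \<bar>v y - u y\<bar>)"
        using kappa_pos[of y] by (intro mult_left_mono) auto
      also have "\<dots> \<le> B + e" unfolding distrib_left using B[of y] v(2)[of y] by simp
      finally show ?thesis .
    qed
    then have Sv: "\<kappa> x * \<bar>S l t v x\<bar> \<le> exp (\<alpha> * t) * (B + e)"
      by (rule S_weighted_bound_Lip_b[OF l t v(1)])
    have "\<kappa> x * \<bar>S l t u x\<bar> \<le> \<kappa> x * (\<bar>S l t v x\<bar> + \<bar>S l t v x - S l t u x\<bar>)"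
      using kappa_pos[of x] by (intro mult_left_mono) auto
    also have "\<dots> \<le> exp (\<alpha> * t) * (B + e) + e" unfolding distrib_left[of "\<kappa> x"] using Sv Svu by simp
    finally show ?thesis .
  qed
  moreover have "((\<lambda>e. exp (\<alpha> * t) * (B + e) + e) \<longlongrightarrow> exp (\<alpha> * t) * B) (at_right 0)"
    by (auto intro!: tendsto_eq_intros)
  ultimately show ?thesis
    by (intro tendsto_lowerbound[of "\<lambda>e. exp (\<alpha> * t) * (B + e) + e" _ "at_right 0"])
       (auto simp: eventually_at_filter)
qed

lemma S_admissible:
  assumes l: "l \<in> \<Lambda>" and t: "0 \<le> t"
  shows "admissible (exp (\<alpha> * t)) (exp (\<beta> * t)) (S l t)"
proof -
  have "(exp (\<beta> * t) * L)-lipschitz_on UNIV (S l t u)" and "\<bar>S l t u x\<bar> \<le> B"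
    if u: "L-lipschitz_on UNIV u" "\<forall>x. \<bar>u x\<bar> \<le> B" for u :: "'a \<Rightarrow> real" and L B x
  proof -
    have uLip: "u \<in> Lip_b" using Lip_bI[OF u(1)] u(2) by blast
    note uUC = Lip_b_subset_UC[OF uLip]
    have L: "0 \<le> L" by (rule lipschitz_on_nonneg[OF u(1)])
    have "Lip_norm (S l t u) \<le> ennreal (exp (\<beta> * t)) * ennreal L"
      using Lip_growth[OF l t uLip] u(1) Lip_norm_le_ennreal_iff[OF L]
      by (meson mult_left_mono order_trans zero_le)
    also have "\<dots> = ennreal (exp (\<beta> * t) * L)" using L by (simp add: ennreal_mult)
    finally show "(exp (\<beta> * t) * L)-lipschitz_on UNIV (S l t u)"
      by (rule Lip_norm_le_ennreal_iff[THEN iffD1, rotated]) (use L in simp)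
    have const: "S l t (\<lambda>_. c) = (\<lambda>_. c)" for c
      using S_cmult[OF l t UC_const[of 1], of c] one[OF l t] by simp
    have "S l t (\<lambda>_. - B) \<le> S l t u" "S l t u \<le> S l t (\<lambda>_. B)"
      using S_monotone[OF l t] uUC UC_const u(2)
      by (auto simp: monotone_op_def le_fun_def abs_le_iff minus_le_iff)
    then show "\<bar>S l t u x\<bar> \<le> B" unfolding const by (auto simp: le_fun_def abs_le_iff minus_le_iff)
  qed
  moreover have "\<kappa> x * \<bar>S l t u x - S l t v x\<bar> \<le> exp (\<alpha> * t) * B"
    if "u \<in> UC \<kappa>" "v \<in> UC \<kappa>" "\<forall>x. \<kappa> x * \<bar>u x - v x\<bar> \<le> B" for u v B x
    using S_weighted_bound[OF l t UC_diff[OF that(1,2)], of B x] that(3) S_diff[OF l t that(1,2)]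
    by simp
  moreover have "sublinear_op \<kappa> (S l t)"
    unfolding sublinear_op_def
    by (intro conjI ballI allI impI S_cmult[OF l t]) (simp_all only: S_add[OF l t] order_refl)
  ultimately show ?thesis
    unfolding admissible_def
    by (intro conjI ballI allI impI S_UC[OF l t] S_monotone[OF l t] S_below[OF l t]) simp_all
qed

lemma step_admissible: "0 \<le> h \<Longrightarrow> admissible (exp (\<alpha> * h)) (exp (\<beta> * h)) (step h)"
  unfolding E_step_def[abs_def] by (intro admissible_SUP nonempty S_admissible)

lemma E_list_admissible:
  assumes "sorted xs" "xs \<noteq> []"
  shows "admissible (exp (\<alpha> * (last xs - hd xs))) (exp (\<beta> * (last xs - hd xs))) (E_list \<Lambda> S xs)"
  using assms
proof (induction xs)
  case (Cons s ys)
  show ?case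
  proof (cases ys)
    case Nil
    then have "E_list \<Lambda> S (s # ys) = (\<lambda>u. u)" by (simp add: fun_eq_iff)
    then show ?thesis using admissible_id Nil by simp
  next
    case (Cons t ts)
    have "admissible (exp (\<alpha> * (t - s)) * exp (\<alpha> * (last ys - hd ys)))
        (exp (\<beta> * (t - s)) * exp (\<beta> * (last ys - hd ys))) (\<lambda>u. step (t - s) (E_list \<Lambda> S ys u))"
      using Cons.IH Cons.prems Cons by (intro admissible_compose step_admissible) auto
    moreover have "(\<lambda>u. step (t - s) (E_list \<Lambda> S ys u)) = E_list \<Lambda> S (s # ys)"
      by (simp add: Cons fun_eq_iff)
    ultimately show ?thesis by (simp add: Cons algebra_simps flip: exp_add)
  qed
qed simp

lemma E_part_admissible:
  assumes "\<pi> \<in> partitions_upto t"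
  shows "admissible (exp (\<alpha> * t)) (exp (\<beta> * t)) (E_part \<Lambda> S \<pi>)"
  using E_list_admissible[of "sorted_list_of_set \<pi>"] sorted_list_of_partition[OF assms]
  by (simp add: E_part_def[abs_def])

lemma envelope_admissible:
  assumes "0 \<le> t"
  shows "admissible (exp (\<alpha> * t)) (exp (\<beta> * t)) (envelope t)"
  unfolding semigroup_envelope_def[abs_def]
  using partitions_upto_trivial[OF assms] by (intro admissible_SUP E_part_admissible) auto

lemma E_part_le_envelope:
  assumes "\<pi> \<in> partitions_upto t" "u \<in> UC \<kappa>"
  shows "E_part \<Lambda> S \<pi> u \<le> envelope t u"
  unfolding semigroup_envelope_def
  by (intro le_funI cSUP_upper assms admissible_family_bdd_above[OF E_part_admissible])

lemma S_le_step:
  assumes "l \<in> \<Lambda>" "0 \<le> h" "u \<in> UC \<kappa>"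
  shows "S l h u \<le> step h u"
  unfolding E_step_def
  by (intro le_funI cSUP_upper assms admissible_family_bdd_above[OF S_admissible])

lemma step_leI:
  assumes "\<And>l. l \<in> \<Lambda> \<Longrightarrow> S l h u \<le> v"
  shows "step h u \<le> v"
  unfolding E_step_def using assms by (intro le_funI cSUP_least nonempty) (auto simp: le_fun_def)

lemma envelope_leI:
  assumes "0 \<le> t" "\<And>\<pi>. \<pi> \<in> partitions_upto t \<Longrightarrow> E_part \<Lambda> S \<pi> u \<le> v"
  shows "envelope t u \<le> v"
  unfolding semigroup_envelope_def using assms(2) partitions_upto_trivial[OF assms(1)]
  by (intro le_funI cSUP_least) (auto simp: le_fun_def)

lemma step_zero:
  assumes "u \<in> UC \<kappa>"
  shows "step 0 u = u"
  unfolding E_step_def using assms nonempty by (simp add: S_zero fun_eq_iff cong: SUP_cong)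

text \<open>Splitting a step can only increase its value, because the index \<open>\<lambda>\<close> may then be chosen anew
  after the first part.\<close>

lemma step_add_le:
  assumes "0 \<le> h" "0 \<le> k" "u \<in> UC \<kappa>"
  shows "step (h + k) u \<le> step h (step k u)"
proof (rule step_leI)
  fix l assume l: "l \<in> \<Lambda>"
  have k: "step k u \<in> UC \<kappa>" by (rule admissible_UC[OF step_admissible[OF assms(2)] assms(3)])
  have "S l (h + k) u = S l h (S l k u)" by (rule S_add_time[OF l assms])
  also have "\<dots> \<le> S l h (step k u)"
    by (rule admissible_mono[OF S_admissible[OF l assms(1)] S_UC[OF l assms(2,3)] k S_le_step[OF l assms(2,3)]])
  also have "\<dots> \<le> step h (step k u)"
    by (rule S_le_step[OF l assms(1) k])
  finally show "S l (h + k) u \<le> step h (step k u)" .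
qed

text \<open>A new partition point splits exactly one step of the partition, or repeats an existing point and
  then contributes a step of length zero, which is the identity. The bound at the split step reaches
  the outside by monotonicity of the steps around it.\<close>

lemma E_list_insort:
  assumes "sorted xs" "xs \<noteq> []" "hd xs \<le> r" "r \<le> last xs" "u \<in> UC \<kappa>"
  shows "E_list \<Lambda> S xs u \<le> E_list \<Lambda> S (insort r xs) u"
  using assms
proof (induction xs)
  case (Cons s ys)
  show ?case
  proof (cases ys)
    case Nil
    then have "r = s" using Cons.prems by simp
    then show ?thesis using Nil step_zero[OF \<open>u \<in> UC \<kappa>\<close>] by simp
  next
    case ys: (Cons t ts)
    have "sorted ys" "s \<le> t" "ys \<noteq> []" using Cons.prems ys by auto
    let ?v = "E_list \<Lambda> S ys u"
    have v: "?v \<in> UC \<kappa>"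
      using E_list_admissible[OF \<open>sorted ys\<close> \<open>ys \<noteq> []\<close>] \<open>u \<in> UC \<kappa>\<close> admissible_UC by blast
    consider "r = s" | "s < r" "r \<le> t" | "t < r" using Cons.prems by fastforce
    then show ?thesis
    proof cases
      case 1
      have "E_list \<Lambda> S (s # ys) u \<in> UC \<kappa>"
        using E_list_admissible[OF Cons.prems(1)] \<open>u \<in> UC \<kappa>\<close> admissible_UC by blast
      then show ?thesis using 1 ys step_zero by simp
    next
      case 2
      then show ?thesis using step_add_le[of "r - s" "t - r" ?v] v ys by simp
    next
      case 3
      have IH: "?v \<le> E_list \<Lambda> S (insort r ys) u"
        using Cons.IH Cons.prems 3 ys by simp
      have "E_list \<Lambda> S (insort r ys) u \<in> UC \<kappa>"
        using E_list_admissible[of "insort r ys"] \<open>sorted ys\<close> \<open>u \<in> UC \<kappa>\<close> admissible_UC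
        by (simp add: sorted_insort)
      then have "step (t - s) ?v \<le> step (t - s) (E_list \<Lambda> S (insort r ys) u)"
        using \<open>s \<le> t\<close> by (intro admissible_mono[OF step_admissible] v IH) auto
      then show ?thesis using 3 \<open>s \<le> t\<close> ys by simp
    qed
  qed
qed simp

lemma E_part_insert:
  assumes "\<pi> \<in> partitions_upto t" "r \<in> {0..t}" "u \<in> UC \<kappa>"
  shows "E_part \<Lambda> S \<pi> u \<le> E_part \<Lambda> S (insert r \<pi>) u"
proof (cases "r \<in> \<pi>")
  case True
  then show ?thesis by (simp add: insert_absorb)
next
  case False
  then have "sorted_list_of_set (insert r \<pi>) = insort r (sorted_list_of_set \<pi>)"
    using partitions_uptoD[OF assms(1)] by simp
  then show ?thesis
    using E_list_insort[of "sorted_list_of_set \<pi>" r u] sorted_list_of_partition[OF assms(1)] assms(2,3)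
    by (simp add: E_part_def)
qed

lemma E_part_refine:
  assumes "\<pi> \<in> partitions_upto t" "finite \<rho>" "\<rho> \<subseteq> {0..t}" "u \<in> UC \<kappa>"
  shows "E_part \<Lambda> S \<pi> u \<le> E_part \<Lambda> S (\<pi> \<union> \<rho>) u"
  using assms(2,3)
proof (induction \<rho>)
  case (insert r \<rho>)
  then have "\<pi> \<union> \<rho> \<in> partitions_upto t"
    by (intro partitions_upto_Un assms(1)) auto
  then have "E_part \<Lambda> S (\<pi> \<union> \<rho>) u \<le> E_part \<Lambda> S (insert r (\<pi> \<union> \<rho>)) u"
    using insert.prems by (intro E_part_insert assms(4)) auto
  with insert show ?case by (auto intro: order_trans)
qed simp

lemma envelope_zero:
  assumes "u \<in> UC \<kappa>"
  shows "envelope 0 u = u"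
  by (simp add: semigroup_envelope_def partitions_upto_zero E_part_def)

text \<open>After adding \<open>s\<close> as a partition point, a partition of \<open>[0, s + t]\<close> is a partition of \<open>[0, s]\<close>
  followed by a shifted partition of \<open>[0, t]\<close>, and each part is dominated by its envelope.\<close>

lemma envelope_add_le:
  assumes s: "0 \<le> s" and t: "0 \<le> t" and u: "u \<in> UC \<kappa>"
  shows "envelope (s + t) u \<le> envelope s (envelope t u)"
proof (rule envelope_leI)
  fix \<pi> assume p: "\<pi> \<in> partitions_upto (s + t)"
  have "insert s \<pi> \<in> partitions_upto (s + t)"
    using partitions_upto_Un[OF p, of "{s}"] s t by simp
  then obtain \<pi>1 \<pi>2 where split: "\<pi>1 \<in> partitions_upto s" "\<pi>2 \<in> partitions_upto t"
      "insert s \<pi> = \<pi>1 \<union> (+) s ` \<pi>2"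
    by (rule partition_split) simp
  have UC: "E_part \<Lambda> S \<pi>2 u \<in> UC \<kappa>" "envelope t u \<in> UC \<kappa>"
    using admissible_UC[OF E_part_admissible[OF split(2)] u] admissible_UC[OF envelope_admissible[OF t] u] .
  have "E_part \<Lambda> S \<pi> u \<le> E_part \<Lambda> S (insert s \<pi>) u"
    using s t by (intro E_part_insert[OF p] u) simp
  also have "\<dots> = E_part \<Lambda> S \<pi>1 (E_part \<Lambda> S \<pi>2 u)"
    unfolding split(3) by (rule E_part_concat[OF split(1,2)])
  also have "\<dots> \<le> E_part \<Lambda> S \<pi>1 (envelope t u)"
    by (intro admissible_mono[OF E_part_admissible[OF split(1)]] UC E_part_le_envelope[OF split(2) u])
  also have "\<dots> \<le> envelope s (envelope t u)"
    by (rule E_part_le_envelope[OF split(1) UC(2)])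
  finally show "E_part \<Lambda> S \<pi> u \<le> envelope s (envelope t u)" .
qed (use s t in simp)

text \<open>By refinement, with the union as common refinement, the family of all \<open>E_part \<Lambda> S \<pi> u\<close> is directed, and for bounded Lipschitz \<open>u\<close> it
  is equi-Lipschitz, so an increasing sequence exhausts the supremum.\<close>

lemma envelope_sequence:
  assumes t: "0 \<le> t" and u: "u \<in> Lip_b"
  obtains p where "\<And>n. p n \<in> partitions_upto t" "increases_to (\<lambda>n. E_part \<Lambda> S (p n) u) (envelope t u)"
proof -
  obtain L B where L: "L-lipschitz_on UNIV u" "\<And>x. \<bar>u x\<bar> \<le> B" using Lip_bE[OF u] by blast
  note uUC = Lip_b_subset_UC[OF u]
  show ?thesis
  proof (rule directed_lipschitz_SUP_sequence[OF separable])
    show "partitions_upto t \<noteq> {}" using partitions_upto_trivial[OF t] by blast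
    show "(exp (\<beta> * t) * L)-lipschitz_on UNIV (E_part \<Lambda> S \<pi> u)" if "\<pi> \<in> partitions_upto t" for \<pi>
      by (rule admissible_lipschitz[OF E_part_admissible[OF that] L])
    show "bdd_above ((\<lambda>\<pi>. E_part \<Lambda> S \<pi> u x) ` partitions_upto t)" for x
      by (rule admissible_family_bdd_above[OF E_part_admissible uUC])
    show "\<exists>\<tau>\<in>partitions_upto t. E_part \<Lambda> S \<pi> u \<le> E_part \<Lambda> S \<tau> u \<and> E_part \<Lambda> S \<rho> u \<le> E_part \<Lambda> S \<tau> u"
      if p: "\<pi> \<in> partitions_upto t" and r: "\<rho> \<in> partitions_upto t" for \<pi> \<rho>
      using partitions_upto_Un[OF p, of \<rho>] E_part_refine[OF p _ _ uUC, of \<rho>] E_part_refine[OF r _ _ uUC, of \<pi>]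
        partitions_uptoD(1,2)[OF p] partitions_uptoD(1,2)[OF r]
      by (intro bexI[of _ "\<pi> \<union> \<rho>"]) (auto simp: Un_commute)
  qed (rule that[unfolded semigroup_envelope_def])
qed

text \<open>Continuity from below moves the supremum over the inner partition out of the outer
  operator.\<close>

lemma envelope_add_ge_Lip_b:
  assumes s: "0 \<le> s" and t: "0 \<le> t" and u: "u \<in> Lip_b"
  shows "envelope s (envelope t u) \<le> envelope (s + t) u"
proof (rule envelope_leI[OF s])
  note uUC = Lip_b_subset_UC[OF u]
  fix \<pi> assume p: "\<pi> \<in> partitions_upto s"
  obtain q where q: "\<And>n. q n \<in> partitions_upto t"
    and inc: "increases_to (\<lambda>n. E_part \<Lambda> S (q n) u) (envelope t u)"
    using envelope_sequence[OF t u] by blast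
  have "increases_to (\<lambda>n. E_part \<Lambda> S \<pi> (E_part \<Lambda> S (q n) u)) (E_part \<Lambda> S \<pi> (envelope t u))"
    using admissible_UC[OF envelope_admissible[OF t] uUC] admissible_UC[OF E_part_admissible[OF q] uUC] inc
    by (rule admissible_increases_to[OF E_part_admissible[OF p]])
  then have lim: "(\<lambda>n. E_part \<Lambda> S \<pi> (E_part \<Lambda> S (q n) u) x) \<longlonglongrightarrow> E_part \<Lambda> S \<pi> (envelope t u) x" for x
    by (simp add: increases_to_def)
  have "E_part \<Lambda> S \<pi> (E_part \<Lambda> S (q n) u) x \<le> envelope (s + t) u x" for n x
    using E_part_le_envelope[OF partitions_upto_concat[OF p q] uUC] 
    by (simp add: E_part_concat[OF p q] le_fun_def)
  then show "E_part \<Lambda> S \<pi> (envelope t u) \<le> envelope (s + t) u"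
    by (intro le_funI LIMSEQ_le_const2[OF lim]) auto
qed

lemma envelope_add:
  assumes s: "0 \<le> s" and t: "0 \<le> t" and u: "u \<in> UC \<kappa>"
  shows "envelope (s + t) u = envelope s (envelope t u)"
proof (rule antisym)
  show "envelope (s + t) u \<le> envelope s (envelope t u)" by (rule envelope_add_le[OF assms])
  show "envelope s (envelope t u) \<le> envelope (s + t) u"
    using admissible_compose[OF envelope_admissible[OF s] envelope_admissible[OF t]]
      envelope_admissible[OF add_nonneg_nonneg[OF s t]] envelope_add_ge_Lip_b[OF s t] u
    by (rule le_on_UC_if_le_on_Lip_b)
qed

lemma envelope_Feller: "Feller_semigroup \<kappa> envelope"
  unfolding Feller_semigroup_def semigroup_on_UC_def
  by (intro conjI allI impI ballI envelope_zero envelope_add admissible_UC[OF envelope_admissible]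
      admissible_continuous_op[OF envelope_admissible])
    (use envelope_admissible in \<open>auto simp: admissible_def\<close>)

lemma S_le_envelope:
  assumes l: "l \<in> \<Lambda>" and t: "0 \<le> t" and u: "u \<in> UC \<kappa>"
  shows "S l t u \<le> envelope t u"
proof (cases "t = 0")
  case True
  then show ?thesis using S_zero[OF l u] envelope_zero[OF u] by simp
next
  case False
  then have "sorted_list_of_set {0, t} = [0, t]" using t by simp
  then have "E_part \<Lambda> S {0, t} u = step t u" by (simp add: E_part_def)
  then show ?thesis
    using S_le_step[OF l t u] E_part_le_envelope[OF partitions_upto_trivial[OF t] u] by simp
qed

text \<open>The steps are replaced by \<open>T\<close> from the innermost one outwards. At each stage the remaining step
  is monotone, which lets the induction hypothesis pass under it, and is then itself dominated by
  \<open>T\<close>.\<close>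

lemma E_list_le_upper_bound:
  assumes T: "semigroup_upper_bound \<kappa> \<Lambda> S T" and u: "u \<in> UC \<kappa>" and "sorted xs" "xs \<noteq> []"
  shows "E_list \<Lambda> S xs u \<le> T (last xs - hd xs) u"
  using assms(3,4)
proof (induction xs)
  case (Cons s ys)
  note T' = T[unfolded semigroup_upper_bound_def semigroup_on_UC_def semigroup_le_def]
  have T_UC: "T t v \<in> UC \<kappa>" and T_zero: "T 0 v = v"
    and T_add: "0 \<le> r \<Longrightarrow> T (r + t) v = T r (T t v)"
    if "0 \<le> t" "v \<in> UC \<kappa>" for r t v
    using T' that by blast+
  have step_le: "step t v \<le> T t v" if "0 \<le> t" "v \<in> UC \<kappa>" for t v
    by (rule step_leI) (use T' that in blast)
  show ?case
  proof (cases ys)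
    case Nil
    then show ?thesis using T_zero[OF order_refl u] by simp
  next
    case ys: (Cons t ts)
    have ord: "sorted ys" "ys \<noteq> []" "s \<le> t" "t \<le> last ys" using Cons.prems ys by auto
    have IH: "E_list \<Lambda> S ys u \<le> T (last ys - t) u" using Cons.IH ord ys by simp
    have TUC: "T (last ys - t) u \<in> UC \<kappa>" using T_UC u ord by simp
    have "E_list \<Lambda> S (s # ys) u = step (t - s) (E_list \<Lambda> S ys u)" using ys by simp
    also have "\<dots> \<le> step (t - s) (T (last ys - t) u)"
      using ord admissible_UC[OF E_list_admissible u] 
      by (intro admissible_mono[OF step_admissible] TUC IH) auto
    also have "\<dots> \<le> T (t - s) (T (last ys - t) u)"
      using ord by (intro step_le TUC) simp
    also have "\<dots> = T (last ys - s) u"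
      using T_add[of "last ys - t" u "t - s"] ord u by simp
    finally show ?thesis using ord by simp
  qed
qed simp

lemma envelope_least:
  assumes "semigroup_upper_bound \<kappa> \<Lambda> S T"
  shows "semigroup_le \<kappa> envelope T"
  unfolding semigroup_le_def
proof (intro allI impI ballI envelope_leI)
  fix t :: real and u \<pi> assume "u \<in> UC \<kappa>" and p: "\<pi> \<in> partitions_upto t"
  then show "E_part \<Lambda> S \<pi> u \<le> T t u"
    using E_list_le_upper_bound[OF assms, of u "sorted_list_of_set \<pi>"] sorted_list_of_partition[OF p]
    by (simp add: E_part_def)
qed

lemma envelope_least_upper_bound: "semigroup_least_upper_bound \<kappa> \<Lambda> S envelope"
  using envelope_Feller S_le_envelope envelope_least
  by (auto simp: semigroup_least_upper_bound_def semigroup_upper_bound_def semigroup_le_def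
      Feller_semigroup_def)

end

theorem theorem2p5:
  fixes \<kappa> :: "'a::metric_space \<Rightarrow> real"
    and \<Lambda> :: "'l set"
    and S :: "'l \<Rightarrow> real \<Rightarrow> ('a \<Rightarrow> real) \<Rightarrow> ('a \<Rightarrow> real)"
    and \<alpha> \<beta> :: real
  assumes separable: "separable_space (euclidean :: 'a topology)"
    and kappa_cont: "continuous_on UNIV \<kappa>"
    and kappa_pos: "\<And>x. 0 < \<kappa> x"
    and kappa_bdd: "bounded (range \<kappa>)"
    and nonempty: "\<Lambda> \<noteq> {}"
    and A1_Feller: "\<And>l. l \<in> \<Lambda> \<Longrightarrow> Feller_semigroup \<kappa> (S l)"
    and A1_linear: "\<And>l t. l \<in> \<Lambda> \<Longrightarrow> 0 \<le> t \<Longrightarrow> linear_op \<kappa> (S l t)"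
    and A1_one: "\<And>l t. l \<in> \<Lambda> \<Longrightarrow> 0 \<le> t \<Longrightarrow> S l t (\<lambda>_. 1) = (\<lambda>_. 1)"
    and A2_norm: "\<And>l t u. l \<in> \<Lambda> \<Longrightarrow> 0 \<le> t \<Longrightarrow> u \<in> Lip_b \<Longrightarrow>
      weighted_norm \<kappa> (S l t u) \<le> ennreal (exp (\<alpha> * t)) * weighted_norm \<kappa> u"
    and A2_Lip: "\<And>l t u. l \<in> \<Lambda> \<Longrightarrow> 0 \<le> t \<Longrightarrow> u \<in> Lip_b \<Longrightarrow>
      Lip_norm (S l t u) \<le> ennreal (exp (\<beta> * t)) * Lip_norm u"
  shows "Feller_semigroup \<kappa> (semigroup_envelope \<Lambda> S)
    \<and> (\<forall>t\<ge>0. sublinear_op \<kappa> (semigroup_envelope \<Lambda> S t))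
    \<and> semigroup_least_upper_bound \<kappa> \<Lambda> S (semigroup_envelope \<Lambda> S)"
proof -
  interpret linear_semigroup_family \<kappa> \<Lambda> S \<alpha> \<beta>
    by unfold_locales (fact assms)+
  have "sublinear_op \<kappa> (semigroup_envelope \<Lambda> S t)" if "0 \<le> t" for t
    using envelope_admissible[OF that] by (simp add: admissible_def)
  then show ?thesis
    using envelope_Feller envelope_least_upper_bound by blast
qed

end
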